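(* Let $\tau>0$. Assume that $\sigma\in\Omega^{2}(\mathbb{T}^{2})$ is non-resonant in period $\tau$, that $V\in C^{\infty}(\mathbb{S}_{\tau}\times\mathbb{T}^{2},\mathbb{R})$, and that $w\in\mathcal{P}_{\tau}^{h}(\sigma,V)$ is nondegenerate for some $h\in\pi_{1}(\mathbb{T}^{2})$ with $h\neq 0$. Then $\#\mathcal{P}_{\tau}^{h}(\sigma,V)\geq 2$.
   Context: $\mathbb{T}^{2}=\mathbb{R}^{2}/\mathbb{Z}^{2}$ with the flat metric, $\mu=dx_1\wedge dx_2$, $\mathbb{S}_{\tau}=\mathbb{R}/\tau\mathbb{Z}$. On $T^{*}\mathbb{T}^{2}$, with footpoint projection $\pi$ and coordinates $(x,p)$, let $\lambda=p_1dx_1+p_2dx_2$ be the Liouville 1-form and $\omega_{\sigma}=d\lambda+\pi^{*}\sigma$ the magnetic symplectic form. Put $H_{V}(t,x,p)=\frac12|p|^{2}+V(t,x)$ and let $X_{\sigma,V}$ be the (time-dependent) vector field defined by $\omega_{\sigma}(X_{\sigma,V},\cdot)=-dH_{V}$, with flow $\phi^{t}_{\sigma,V}$. $\mathcal{P}_{\tau}(\sigma,V)$ is the set of $w\in C^{\infty}(\mathbb{S}_{\tau},T^{*}\mathbb{T}^{2})$ with $\partial_t w=X_{\sigma,V}(t,w)$, and for $h\in\mathbb{Z}^{2}=\pi_1(\mathbb{T}^{2})=\pi_{1}(T^{*}\mathbb{T}^{2})$, $\mathcal{P}_{\tau}^{h}(\sigma,V)$ is the subset of those representing $h$. An element $w$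 is nondegenerate if $\det(D\phi^{\tau}_{\sigma,V}(w(0))-\mathrm{Id})\neq 0$. Write $\sigma=a\mu$ with $a\in C^{\infty}(\mathbb{T}^{2},\mathbb{R})$. The form $\sigma$ is non-resonant in period $\tau$ if there is $k\in\mathbb{Z}$ with $\frac{2\pi k}{\tau}<a(x)<\frac{2\pi(k+1)}{\tau}$ for all $x\in\mathbb{T}^{2}$. *)

theory Defs
  imports "HOL-Analysis.Analysis"
begin

primrec times_cont_differentiable ::
  "nat \<Rightarrow> ('a::real_normed_vector \<Rightarrow> 'b::real_normed_vector) \<Rightarrow> bool" where
  "times_cont_differentiable 0 f \<longleftrightarrow> continuous_on UNIV f"
| "times_cont_differentiable (Suc n) f \<longleftrightarrow>
     f differentiable_on UNIV \<and>
     (\<forall>v. times_cont_differentiable n (\<lambda>x. frechet_derivative f (at x) v))"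

definition smooth :: "('a::euclidean_space \<Rightarrow> 'b::real_normed_vector) \<Rightarrow> bool" where
  "smooth f \<longleftrightarrow> (\<forall>n. times_cont_differentiable n f)"

definition lattice_equiv :: "real^2 \<Rightarrow> real^2 \<Rightarrow> bool" where
  "lattice_equiv x y \<longleftrightarrow> (\<forall>i. x $ i - y $ i \<in> \<int>)"

lemma equivp_lattice_equiv: "equivp lattice_equiv"
proof (rule equivpI)
  show "reflp lattice_equiv"
    by (auto simp: reflp_def lattice_equiv_def)
  show "symp lattice_equiv"
    unfolding symp_def lattice_equiv_def by (metis Ints_minus minus_diff_eq)
  show "transp lattice_equiv"
    unfolding transp_def lattice_equiv_def
  proof (intro allI impI)
    fix x y z :: "real^2" and i
    assume "\<forall>i. x $ i - y $ i \<in> \<int>" "\<forall>i. y $ i - z $ i \<in> \<int>"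
    then have "(x $ i - y $ i) + (y $ i - z $ i) \<in> \<int>"
      by (intro Ints_add) auto
    then show "x $ i - z $ i \<in> \<int>" by simp
  qed
qed

quotient_type torus = "real^2" / lattice_equiv
  by (rule equivp_lattice_equiv)

lift_definition torus_proj :: "real^2 \<Rightarrow> torus" is "\<lambda>x. x" .

lift_definition torus_translate :: "torus \<Rightarrow> real^2 \<Rightarrow> torus" is "\<lambda>x v. x + v"
  by (simp add: lattice_equiv_def)

text \<open>The cotangent bundle of the torus is trivialised by \<open>dx\<^sub>1, dx\<^sub>2\<close>. Its tangent space at any
  point is identified with \<open>(real^2) \<times> (real^2)\<close>, the components of a tangent vector being those of
  \<open>dx\<close> and \<open>dp\<close>; this identification is the derivative at \<open>0\<close> of \<open>cotangent_translate z\<close>.\<close>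

type_synonym cotangent = "torus \<times> (real^2)"
type_synonym tangent = "(real^2) \<times> (real^2)"

definition cotangent_proj :: "(real^2) \<times> (real^2) \<Rightarrow> cotangent" where
  "cotangent_proj W = (torus_proj (fst W), snd W)"

definition cotangent_translate :: "cotangent \<Rightarrow> tangent \<Rightarrow> cotangent" where
  "cotangent_translate z u = (torus_translate (fst z) (fst u), snd z + snd u)"

type_synonym torus_form2 = "torus \<Rightarrow> real^2 \<Rightarrow> real^2 \<Rightarrow> real"

definition torus_two_form :: "torus_form2 \<Rightarrow> bool" where
  "torus_two_form \<sigma> \<longleftrightarrow>
     (\<forall>q. bilinear (\<sigma> q) \<and> (\<forall>u. \<sigma> q u u = 0)) \<and>
     (\<forall>u v. smooth (\<lambda>x. \<sigma> (torus_proj x) u v))"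

definition area_form :: torus_form2 where
  "area_form q u v = u $ 1 * v $ 2 - u $ 2 * v $ 1"

definition nonresonant :: "real \<Rightarrow> torus_form2 \<Rightarrow> bool" where
  "nonresonant \<tau> \<sigma> \<longleftrightarrow>
     (\<exists>a :: torus \<Rightarrow> real.
        smooth (\<lambda>x. a (torus_proj x)) \<and>
        (\<forall>q u v. \<sigma> q u v = a q * area_form q u v) \<and>
        (\<exists>k::int. \<forall>q. 2 * pi * of_int k / \<tau> < a q \<and> a q < 2 * pi * (of_int k + 1) / \<tau>))"

definition cotangent_differential :: "(cotangent \<Rightarrow> real) \<Rightarrow> cotangent \<Rightarrow> tangent \<Rightarrow> real" where
  "cotangent_differential f z v =
     frechet_derivative (\<lambda>u. f (cotangent_translate z u)) (at 0) v"

text \<open>The formula \<open>d\<alpha>(u, v) = u(\<alpha>(v)) - v(\<alpha>(u)) - \<alpha>([u, v])\<close>, evaluated on translation invariant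
  vector fields, whose brackets vanish.\<close>

definition exterior_derivative ::
  "(cotangent \<Rightarrow> tangent \<Rightarrow> real) \<Rightarrow> cotangent \<Rightarrow> tangent \<Rightarrow> tangent \<Rightarrow> real" where
  "exterior_derivative \<alpha> z u v =
     cotangent_differential (\<lambda>y. \<alpha> y v) z u - cotangent_differential (\<lambda>y. \<alpha> y u) z v"

definition liouville_form :: "cotangent \<Rightarrow> tangent \<Rightarrow> real" where
  "liouville_form z u = snd z \<bullet> fst u"

definition magnetic_form :: "torus_form2 \<Rightarrow> cotangent \<Rightarrow> tangent \<Rightarrow> tangent \<Rightarrow> real" where
  "magnetic_form \<sigma> z u v =
     exterior_derivative liouville_form z u v + \<sigma> (fst z) (fst u) (fst v)"

text \<open>Functions on \<open>\<real>/\<tau>\<int>\<close> are represented by \<open>\<tau>\<close>-periodic functions on \<open>\<real>\<close>.\<close>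

definition periodic_potential :: "real \<Rightarrow> (real \<Rightarrow> torus \<Rightarrow> real) \<Rightarrow> bool" where
  "periodic_potential \<tau> V \<longleftrightarrow>
     (\<forall>t q. V (t + \<tau>) q = V t q) \<and>
     smooth (\<lambda>(t, x). V t (torus_proj x))"

definition hamiltonian :: "(real \<Rightarrow> torus \<Rightarrow> real) \<Rightarrow> real \<Rightarrow> cotangent \<Rightarrow> real" where
  "hamiltonian V t z = (norm (snd z))\<^sup>2 / 2 + V t (fst z)"

definition hamiltonian_field ::
  "torus_form2 \<Rightarrow> (real \<Rightarrow> torus \<Rightarrow> real) \<Rightarrow> real \<Rightarrow> cotangent \<Rightarrow> tangent" where
  "hamiltonian_field \<sigma> V t z =
     (THE X. \<forall>v. magnetic_form \<sigma> z X v = - cotangent_differential (hamiltonian V t) z v)"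

definition integral_curve ::
  "torus_form2 \<Rightarrow> (real \<Rightarrow> torus \<Rightarrow> real) \<Rightarrow> (real \<Rightarrow> cotangent) \<Rightarrow> bool" where
  "integral_curve \<sigma> V w \<longleftrightarrow>
     (\<exists>W. \<forall>t. w t = cotangent_proj (W t) \<and>
       (W has_vector_derivative hamiltonian_field \<sigma> V t (w t)) (at t))"

text \<open>The field grows at most linearly in \<open>p\<close>, so for smooth data every maximal integral curve is
  defined on all of \<open>\<real>\<close> and the description below determines the flow starting at time \<open>0\<close>.\<close>

definition magnetic_flow ::
  "torus_form2 \<Rightarrow> (real \<Rightarrow> torus \<Rightarrow> real) \<Rightarrow> real \<Rightarrow> cotangent \<Rightarrow> cotangent" where
  "magnetic_flow \<sigma> V t z = (THE w. integral_curve \<sigma> V w \<and> w 0 = z) t"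

text \<open>Derivative of a self-map of the cotangent bundle, in the trivialisation above. Differentiability
  of \<open>G\<close> at \<open>0\<close> together with \<open>G 0 = 0\<close> makes \<open>G\<close> unique near \<open>0\<close>, hence \<open>L\<close> unique.\<close>

definition has_cotangent_derivative ::
  "(cotangent \<Rightarrow> cotangent) \<Rightarrow> (tangent \<Rightarrow> tangent) \<Rightarrow> cotangent \<Rightarrow> bool" where
  "has_cotangent_derivative F L z \<longleftrightarrow>
     (\<exists>G. (\<forall>u. F (cotangent_translate z u) = cotangent_translate (F z) (G u)) \<and>
          G 0 = 0 \<and> (G has_derivative L) (at 0))"

definition tangent_coords :: "tangent \<Rightarrow> real^4" where
  "tangent_coords u = vector [fst u $ 1, fst u $ 2, snd u $ 1, snd u $ 2]"

definition tangent_of_coords :: "real^4 \<Rightarrow> tangent" where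
  "tangent_of_coords c = (vector [c $ 1, c $ 2], vector [c $ 3, c $ 4])"

definition tangent_det :: "(tangent \<Rightarrow> tangent) \<Rightarrow> real" where
  "tangent_det L = det (matrix (tangent_coords \<circ> L \<circ> tangent_of_coords))"

definition periodic_orbits ::
  "real \<Rightarrow> torus_form2 \<Rightarrow> (real \<Rightarrow> torus \<Rightarrow> real) \<Rightarrow> (real \<Rightarrow> cotangent) set" where
  "periodic_orbits \<tau> \<sigma> V =
     {w. (\<forall>t. w (t + \<tau>) = w t) \<and>
         (\<exists>W. smooth W \<and> w = cotangent_proj \<circ> W) \<and>
         integral_curve \<sigma> V w}"

text \<open>\<open>\<int>\<^sup>2\<close> is identified with the fundamental group of the torus, and with that of its cotangent
  bundle, as the group of deck transformations of the universal covering.\<close>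

definition represents :: "real \<Rightarrow> (real \<Rightarrow> cotangent) \<Rightarrow> int^2 \<Rightarrow> bool" where
  "represents \<tau> w h \<longleftrightarrow>
     (\<exists>W. continuous_on UNIV W \<and> w = cotangent_proj \<circ> W \<and>
          fst (W \<tau>) = fst (W 0) + (\<chi> i. of_int (h $ i)))"

definition periodic_orbits_in_class ::
  "real \<Rightarrow> int^2 \<Rightarrow> torus_form2 \<Rightarrow> (real \<Rightarrow> torus \<Rightarrow> real) \<Rightarrow> (real \<Rightarrow> cotangent) set" where
  "periodic_orbits_in_class \<tau> h \<sigma> V = {w \<in> periodic_orbits \<tau> \<sigma> V. represents \<tau> w h}"

definition nondegenerate_orbit ::
  "real \<Rightarrow> torus_form2 \<Rightarrow> (real \<Rightarrow> torus \<Rightarrow> real) \<Rightarrow> (real \<Rightarrow> cotangent) \<Rightarrow> bool" where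
  "nondegenerate_orbit \<tau> \<sigma> V w \<longleftrightarrow>
     (\<exists>L. has_cotangent_derivative (magnetic_flow \<sigma> V \<tau>) L (w 0) \<and>
          tangent_det (\<lambda>u. L u - u) \<noteq> 0)"

end

theory Submission
  imports Defs
begin

text \<open>On the universal cover the equations of motion are \<open>x' = p\<close>, \<open>p' = - a(x) Jp - \<nabla>V(t, x)\<close>, with \<open>J\<close> the
  rotation by \<open>\<pi>/2\<close>. Let \<open>\<Phi>\<close> be the map after time \<open>\<tau>\<close>. Orbits in the class \<open>h\<close> are the zeros modulo \<open>\<int>\<^sup>2\<close> of
  the \<open>\<int>\<^sup>2\<close>-periodic map \<open>G z = \<Phi> z - z - (h, 0)\<close>. In a frame rotating with angle \<open>\<integral> a(x(t)) dt\<close> the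
  magnetic force disappears, and non-resonance keeps that angle at time \<open>\<tau>\<close> away from \<open>2\<pi>\<int>\<close>; hence the
  \<open>p\<close>-component of \<open>G\<close> has no zeros with \<open>\<bar>p\<bar>\<close> large, and \<open>G\<close> may be deformed there to a nonzero constant.
  The exponential map identifies the product of the torus and the plane with the set of pairs of nonzero
  complex numbers, so the deformed \<open>G\<close> becomes a map from \<open>\<complex>\<^sup>2\<close> to \<open>\<real>\<^sup>4\<close>, constant near infinity
  and near the axes. If its only zero were nondegenerate, the identity of a sphere in \<open>\<complex>\<^sup>2\<close> would be
  null-homotopic.\<close>

section \<open>Zeros of periodic maps\<close>

text \<open>On a small sphere around \<open>y0\<close> the map is close to the inclusion, by the
  derivative. Enlarging the sphere never meets a second zero and ends where the map is constant.
  After normalisation the identity of the unit sphere would be null-homotopic, but spheres are not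
  contractible.\<close>

lemma not_eventually_constant_of_unique_regular_zero:
  fixes f :: "'a::euclidean_space \<Rightarrow> 'a"
  assumes cont: "continuous_on UNIV f"
    and const: "\<And>y. norm y \<ge> \<rho> \<Longrightarrow> f y = c"
    and zero: "\<And>y. f y = 0 \<longleftrightarrow> y = y0"
    and der: "(f has_derivative (\<lambda>u. u)) (at y0)"
  shows False
proof -
  define S where "S = sphere (0::'a) 1"
  obtain d where d: "d > 0" "\<And>y. norm (y - y0) < d \<Longrightarrow> norm (f y - f y0 - (y - y0)) \<le> 1/2 * norm (y - y0)"
    using der unfolding has_derivative_at_alt by (metis half_gt_zero zero_less_one)
  define e where "e = d / 2"
  \<comment> \<open>With this choice the sphere of radius \<open>r + 1\<close> about
    \<open>y0\<close> lies in the region where \<open>f\<close> is the constant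
    \<open>c\<close>.\<close>
  define r where "r = \<bar>\<rho>\<bar> + norm y0"
  have e: "e > 0" "e < d" using d by (auto simp: e_def)
  have fy0: "f y0 = 0" using zero by simp
  have contf: "continuous_on T f" for T
    using cont continuous_on_subset by blast
  \<comment> \<open>The segment stays within \<open>e / 2\<close> of a point of norm
    \<open>e\<close>, so it misses the origin.\<close>
  have h1: "homotopic_with_canon (\<lambda>x. True) S (- {0}) (\<lambda>w. e *\<^sub>R w) (\<lambda>w. f (y0 + e *\<^sub>R w))"
  proof (rule homotopic_with_linear)
    show "continuous_on S (\<lambda>w. e *\<^sub>R w)" "continuous_on S (\<lambda>w. f (y0 + e *\<^sub>R w))"
      by (auto intro!: continuous_intros continuous_on_compose2[OF contf])
    fix w assume "w \<in> S"
    then have w: "norm w = 1" by (simp add: S_def)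
    have ne: "norm (f (y0 + e *\<^sub>R w) - e *\<^sub>R w) \<le> e / 2"
      using d(2)[of "y0 + e *\<^sub>R w"] e w fy0 by simp
    show "closed_segment (e *\<^sub>R w) (f (y0 + e *\<^sub>R w)) \<subseteq> - {0}"
    proof
      fix x assume "x \<in> closed_segment (e *\<^sub>R w) (f (y0 + e *\<^sub>R w))"
      then have "norm (x - e *\<^sub>R w) \<le> norm (f (y0 + e *\<^sub>R w) - e *\<^sub>R w)"
        using segment_bound(1) by blast
      then show "x \<in> - {0}" using ne w e by auto
    qed
  qed
  have h2: "homotopic_with_canon (\<lambda>x. True) S (- {0}) (\<lambda>w. f (y0 + e *\<^sub>R w)) (\<lambda>w. c)"
  proof -
    \<comment> \<open>The radius moves linearly from \<open>e\<close> to \<open>r + 1\<close> and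
      stays positive, so \<open>y0\<close> is never hit.\<close>
    define h where "h = (\<lambda>(s, w). f (y0 + ((1 - s) * e + s * (r + 1)) *\<^sub>R w))"
    have "continuous_on ({0..1} \<times> S) h"
      unfolding h_def case_prod_unfold
      by (auto intro!: continuous_intros continuous_on_compose2[OF contf])
    moreover have "h ` ({0..1} \<times> S) \<subseteq> - {0}"
    proof -
      have "h (s, w) \<noteq> 0" if "s \<in> {0..1}" "w \<in> S" for s w
      proof -
        have "(1 - s) * e + s * (r + 1) > 0"
          using that e by (cases "s = 0") (auto simp: r_def intro!: add_nonneg_pos mult_pos_pos)
        moreover have "w \<noteq> 0" using that by (auto simp: S_def)
        ultimately show ?thesis using zero by (auto simp: h_def)
      qed
      then show ?thesis by auto
    qed
    moreover have "h (1, w) = c" if "w \<in> S" for w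
    proof -
      have "norm (y0 + (r+1) *\<^sub>R w) \<ge> norm ((r+1) *\<^sub>R w) - norm y0"
        by (metis add.commute norm_diff_ineq)
      then have "norm (y0 + (r+1) *\<^sub>R w) \<ge> \<rho>"
        using that by (auto simp: S_def r_def)
      then show ?thesis using const by (auto simp: h_def)
    qed
    moreover have "h (0, w) = f (y0 + e *\<^sub>R w)" for w
      by (simp add: h_def)
    ultimately show ?thesis
      by (subst homotopic_with) (auto intro!: exI[of _ h])
  qed
  have "homotopic_with_canon (\<lambda>x. True) S (- {0}) (\<lambda>w. e *\<^sub>R w) (\<lambda>w. c)"
    using h1 h2 homotopic_with_trans by blast
  \<comment> \<open>\<open>sgn\<close> is the radial retraction onto the unit sphere; it turns the
    scaled inclusion into the identity.\<close>
  moreover have "continuous_on (- {0}) (sgn :: 'a \<Rightarrow> 'a)"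
    by (auto simp: sgn_div_norm intro!: continuous_intros)
  moreover have "(sgn :: 'a \<Rightarrow> 'a) ` (- {0}) \<subseteq> S"
    by (auto simp: S_def norm_sgn split: if_splits)
  ultimately have "homotopic_with_canon (\<lambda>x. True) S S (sgn \<circ> (\<lambda>w. e *\<^sub>R w)) (sgn \<circ> (\<lambda>w. c))"
    by (intro homotopic_with_compose_continuous_left) auto
  then have "homotopic_with_canon (\<lambda>x. True) S S id (\<lambda>w. sgn c)"
    by (rule homotopic_with_eq) (use e in \<open>auto simp: S_def sgn_div_norm\<close>)
  then have "contractible S"
    unfolding contractible_def by blast
  then show False
    by (simp add: S_def contractible_sphere)
qed

text \<open>Logarithmic coordinates: the pair \<open>(exp a, exp b)\<close> of nonzero complex
  numbers stands for the point of torus times plane whose angles are the arguments divided by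
  \<open>2 * pi\<close> and whose momenta are the logarithms of the moduli.\<close>

definition winding_chart :: "complex \<times> complex \<Rightarrow> (real^2) \<times> (real^2)" where
  "winding_chart = (\<lambda>(a, b). (vector [Im a / (2 * pi), Im b / (2 * pi)], vector [Re a, Re b]))"

lemma winding_chart_eq:
  "winding_chart w = ((\<chi> i. Im (if i = 1 then fst w else snd w) / (2 * pi)),
     (\<chi> i. Re (if i = 1 then fst w else snd w)))"
  by (auto simp: winding_chart_def vec_eq_iff forall_2 split: prod.split)

lemma bounded_linear_winding_chart: "bounded_linear winding_chart"
proof -
  have "linear winding_chart"
    by (rule linearI) (auto simp: winding_chart_eq vec_eq_iff add_divide_distrib)
  then show ?thesis by (simp add: linear_conv_bounded_linear)
qed

lemma inj_winding_chart: "inj winding_chart"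
  by (auto simp: inj_def winding_chart_eq vec_eq_iff forall_2 complex_eq_iff)

lemma norm_snd_winding_chart_ge:
  "\<bar>Re a\<bar> \<le> norm (snd (winding_chart (a, b)))" "\<bar>Re b\<bar> \<le> norm (snd (winding_chart (a, b)))"
  using component_le_norm_cart[of "snd (winding_chart (a, b))" 1]
    component_le_norm_cart[of "snd (winding_chart (a, b))" 2]
  by (auto simp: winding_chart_def)

text \<open>Read through the logarithmic chart, \<open>H\<close> becomes a single-valued map on
  pairs of nonzero complex numbers. Moduli near 0 or infinity mean large momentum, where
  \<open>H\<close> equals \<open>c\<close>, so setting the value \<open>c\<close> on the axes gives
  a continuous map that is constant outside a ball. Composing with the inverse of its derivative at
  the zero reduces to the preceding obstruction.\<close>

lemma periodic_zero_constant_end_impossible: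
  fixes H :: "(real^2) \<times> (real^2) \<Rightarrow> (real^2) \<times> (real^2)"
  assumes cont: "continuous_on UNIV H"
    and per: "\<And>x n p. (\<forall>i. n $ i \<in> \<int>) \<Longrightarrow> H (x + n, p) = H (x, p)"
    and const: "\<And>x p. norm p \<ge> R \<Longrightarrow> H (x, p) = c"
    and c: "c \<noteq> 0"
    and zero: "H z0 = 0"
    and uniq: "\<And>z. H z = 0 \<Longrightarrow> snd z = snd z0 \<and> (\<forall>i. fst z $ i - fst z0 $ i \<in> \<int>)"
    and der: "(H has_derivative L) (at z0)" and inj: "inj L"
  shows False
proof -
  \<comment> \<open>Centring at \<open>z0\<close> places the zero at \<open>(1, 1)\<close>, the
    image of the origin under the exponentials.\<close>
  define Q where "Q = (\<lambda>w. H (z0 + winding_chart w))"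
  define F where "F = (\<lambda>(u, v). if u = 0 \<or> v = 0 then c else Q (Ln u, Ln v))"
  \<comment> \<open>Changing the branch of a logarithm translates the torus coordinate by a lattice
    vector, so the value does not depend on the branch.\<close>
  have Q_per: "Q (a + (of_int (2 * m) * pi) * \<i>, b + (of_int (2 * n) * pi) * \<i>) = Q (a, b)" for a b m n
  proof -
    define k :: "real^2" where "k = vector [of_int m, of_int n]"
    have "z0 + winding_chart (a + (of_int (2 * m) * pi) * \<i>, b + (of_int (2 * n) * pi) * \<i>)
      = (fst (z0 + winding_chart (a, b)) + k, snd (z0 + winding_chart (a, b)))"
      by (auto simp: prod_eq_iff winding_chart_eq vec_eq_iff forall_2 k_def add_divide_distrib)
    moreover have k: "\<forall>i. k $ i \<in> \<int>" by (auto simp: k_def forall_2)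
    ultimately show ?thesis by (simp only: Q_def per[OF k] prod.collapse)
  qed
  have F_exp: "F (exp a, exp b) = Q (a, b)" for a b
  proof -
    have "exp (Ln (exp a)) = exp a" "exp (Ln (exp b)) = exp b" by simp_all
    then obtain m n :: int where "Ln (exp a) = a + (of_int (2 * m) * pi) * \<i>" "Ln (exp b) = b + (of_int (2 * n) * pi) * \<i>"
      unfolding exp_eq by blast
    then show ?thesis by (simp only: F_def case_prod_conv Q_per exp_not_eq_zero simp_thms if_False)
  qed
  have cont_Q: "continuous_on UNIV Q"
    unfolding Q_def
    by (intro continuous_on_compose2[OF cont] continuous_intros linear_continuous_on bounded_linear_winding_chart) auto
  \<comment> \<open>The summand \<open>norm (snd z0)\<close> compensates for the centring at
    \<open>z0\<close>.\<close>
  define r where "r = \<bar>R\<bar> + norm (snd z0)"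
  have Q_const: "Q (a, b) = c" if "\<bar>Re a\<bar> \<ge> r \<or> \<bar>Re b\<bar> \<ge> r" for a b
  proof -
    have "norm (snd (winding_chart (a, b))) \<ge> r"
      using that norm_snd_winding_chart_ge[where a=a and b=b] by linarith
    moreover have "norm (snd (winding_chart (a, b))) - norm (snd z0) \<le> norm (snd z0 + snd (winding_chart (a, b)))"
      by (metis add.commute norm_diff_ineq)
    ultimately have "norm (snd z0 + snd (winding_chart (a, b))) \<ge> R"
      by (simp add: r_def)
    then show ?thesis
      using const[of "snd z0 + snd (winding_chart (a, b))" "fst z0 + fst (winding_chart (a, b))"]
      by (simp add: Q_def plus_prod_def)
  qed
  have F_const: "F (u, v) = c" if "norm u \<le> exp (- r) \<or> norm u \<ge> exp r \<or> norm v \<le> exp (- r) \<or> norm v \<ge> exp r" for u v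
  proof (cases "u = 0 \<or> v = 0")
    case False
    have *: "\<bar>ln x\<bar> \<ge> r" if "x > 0" "x \<le> exp (- r) \<or> x \<ge> exp r" for x :: real
    proof -
      have "ln x \<le> - r \<or> ln x \<ge> r"
        using that ln_le_cancel_iff[of x "exp (- r)"] ln_le_cancel_iff[of "exp r" x] by auto
      then show ?thesis by linarith
    qed
    show ?thesis
      using False that *[of "norm u"] *[of "norm v"]
      by (auto simp: F_def intro!: Q_const)
  qed (auto simp: F_def)
  have cont_F: "isCont F w" for w
  proof -
    obtain u v where w: "w = (u, v)" by force
    show ?thesis
    proof (cases "u = 0 \<or> v = 0")
      case True
      define S where "S = {w :: complex \<times> complex. norm (fst w) < exp (- r)} \<union> {w. norm (snd w) < exp (- r)}"
      have "open S"
        unfolding S_def by (intro open_Un open_Collect_less continuous_intros)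
      moreover have "w \<in> S" using True by (auto simp: S_def w)
      moreover have "F x = c" if "x \<in> S" for x
        using that F_const[of "fst x" "snd x"] by (auto simp: S_def)
      ultimately have "isCont F w \<longleftrightarrow> isCont (\<lambda>_. c) w"
        by (intro isCont_cong) (auto simp: eventually_nhds)
      then show ?thesis by simp
    next
      case False
      \<comment> \<open>\<open>Ln\<close> may jump at \<open>u\<close> or \<open>v\<close>. The
        branch \<open>Ln (fst w / u) + Ln u\<close> is continuous there, since its quotient is near
        1, and \<open>F_exp\<close> makes \<open>F\<close> agree with it.\<close>
      define G where "G = (\<lambda>w. Q (Ln (fst w / u) + Ln u, Ln (snd w / v) + Ln v))"
      have "isCont G w"
        unfolding G_def
        by (rule continuous_at_compose[where g=Q, unfolded o_def])
          (use False w in \<open>auto intro!: continuous_intros simp: continuous_on_eq_continuous_at[THEN iffD1, OF _ cont_Q]\<close>)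
      moreover have "\<forall>\<^sub>F x in nhds w. F x = G x"
      proof -
        have "open ((- {0}) \<times> (- {0 :: complex}) :: (complex \<times> complex) set)"
          by (intro open_Times) auto
        moreover have "w \<in> (- {0}) \<times> (- {0})" using False w by auto
        moreover have "F x = G x" if "x \<in> (- {0}) \<times> (- {0})" for x
        proof -
          have "x = (exp (Ln (fst x / u) + Ln u), exp (Ln (snd x / v) + Ln v))"
            using that False by (auto simp: exp_add)
          then show ?thesis using F_exp unfolding G_def by metis
        qed
        ultimately show ?thesis unfolding eventually_nhds by blast
      qed
      ultimately show ?thesis by (simp add: isCont_cong)
    qed
  qed
  have F_zero: "F w = 0 \<longleftrightarrow> w = (1, 1)" for w
  proof
    assume F0: "F w = 0"
    obtain u v where w: "w = (u, v)" by force
    have nz: "u \<noteq> 0" "v \<noteq> 0" using F0 c by (auto simp: F_def w split: if_splits)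
    then have "Q (Ln u, Ln v) = 0" using F0 by (simp add: F_def w)
    then have "snd (winding_chart (Ln u, Ln v)) = 0" "\<forall>i. fst (winding_chart (Ln u, Ln v)) $ i \<in> \<int>"
      using uniq[of "z0 + winding_chart (Ln u, Ln v)"] by (auto simp: Q_def)
    then have re: "Re (Ln u) = 0" "Re (Ln v) = 0" and im: "Im (Ln u) / (2 * pi) \<in> \<int>" "Im (Ln v) / (2 * pi) \<in> \<int>"
      by (auto simp: winding_chart_eq vec_eq_iff forall_2)
    have "exp a = 1" if "Re a = 0" "Im a / (2 * pi) \<in> \<int>" for a
    proof -
      obtain n :: int where "Im a / (2 * pi) = of_int n" using \<open>Im a / (2 * pi) \<in> \<int>\<close> by (elim Ints_cases)
      then have "Im a = of_int (2 * n) * pi" by (simp add: field_simps)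
      then show ?thesis using that by (auto simp: exp_eq_1)
    qed
    from this[OF re(1) im(1)] this[OF re(2) im(2)] show "w = (1, 1)"
      using nz w by simp
  next
    assume "w = (1, 1)"
    then have "F w = Q (0, 0)" by (simp add: F_def)
    also have "Q (0, 0) = 0"
      using zero bounded_linear_winding_chart by (simp add: Q_def linear_simps zero_prod_def[symmetric])
    finally show "F w = 0" .
  qed
  have derF: "(F has_derivative (\<lambda>w. L (winding_chart w))) (at (1, 1))"
  proof -
    \<comment> \<open>\<open>Ln\<close> is tangent to the identity at 1, up to a shift, so only the
      linear chart enters the derivative at \<open>(1, 1)\<close>.\<close>
    have Ln1: "(Ln has_derivative (\<lambda>h. h)) (at 1)"
      using has_field_derivative_Ln[of 1] unfolding has_field_derivative_def
      by (rule has_derivative_eq_rhs) (simp_all add: fun_eq_iff)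
    have fst1: "((\<lambda>w. Ln (fst w)) has_derivative fst) (at (1::complex, 1::complex))"
      and snd1: "((\<lambda>w. Ln (snd w)) has_derivative snd) (at (1::complex, 1::complex))"
      using has_derivative_compose[of fst fst "(1,1)" UNIV Ln "\<lambda>h. h"] has_derivative_compose[of snd snd "(1,1)" UNIV Ln "\<lambda>h. h"] Ln1
      by (auto intro: bounded_linear_imp_has_derivative bounded_linear_fst bounded_linear_snd)
    have "((\<lambda>w. z0 + winding_chart (Ln (fst w), Ln (snd w))) has_derivative (\<lambda>w. 0 + winding_chart (fst w, snd w))) (at (1, 1))"
      by (intro has_derivative_add has_derivative_const
          bounded_linear.has_derivative[OF bounded_linear_winding_chart] has_derivative_Pair fst1 snd1)
    then have 1: "((\<lambda>w. z0 + winding_chart (Ln (fst w), Ln (snd w))) has_derivative winding_chart) (at (1, 1))"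
      by simp
    have "z0 + winding_chart (Ln (fst (1, 1)), Ln (snd (1, 1))) = z0"
      using bounded_linear_winding_chart by (simp add: linear_simps zero_prod_def[symmetric])
    then have "((\<lambda>w. Q (Ln (fst w), Ln (snd w))) has_derivative (\<lambda>w. L (winding_chart w))) (at (1, 1))"
      using has_derivative_compose[OF 1, of H L] der unfolding Q_def by simp
    moreover have "\<forall>\<^sub>F w in at (1, 1). Q (Ln (fst w), Ln (snd w)) = F w"
    proof -
      have "open ((- {0}) \<times> (- {0 :: complex}) :: (complex \<times> complex) set)"
        by (intro open_Times) auto
      then show ?thesis unfolding eventually_at_filter eventually_nhds
        by (intro exI[of _ "(- {0}) \<times> (- {0})"]) (auto simp: F_def)
    qed
    ultimately show ?thesis
      by (rule has_derivative_transform_eventually)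
         (simp_all add: F_def)
  qed
  define M where "M = (\<lambda>w. L (winding_chart w))"
  have "linear M"
    using derF by (simp add: M_def has_derivative_linear)
  moreover have "inj M"
    using inj_compose[OF inj inj_winding_chart] by (simp add: M_def o_def)
  ultimately obtain K where K: "linear K" "K \<circ> M = id"
    using linear_injective_left_inverse by blast
  \<comment> \<open>Both sides have real dimension 4. Hence the left inverse \<open>K\<close> is
    injective, and \<open>K \<circ> F\<close> has the same zeros as \<open>F\<close>.\<close>
  have "surj M"
    using \<open>linear M\<close> \<open>inj M\<close> by (rule eucl.linear_injective_imp_surjective) simp
  then have injK: "inj K"
    using K(2) by (metis (no_types, lifting) comp_apply id_apply injI surj_def)
  have blK: "bounded_linear K" using K(1) by (simp add: linear_conv_bounded_linear)
  show False
  proof (rule not_eventually_constant_of_unique_regular_zero)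
    show "continuous_on UNIV (K \<circ> F)"
      by (rule continuous_on_compose)
        (auto intro: linear_continuous_on[OF blK] continuous_at_imp_continuous_on simp: cont_F)
    \<comment> \<open>The factor 2 forces at least one of the two complex components to have modulus
      at least \<open>exp r\<close>.\<close>
    show "(K \<circ> F) w = K c" if "norm w \<ge> 2 * exp r" for w
    proof -
      have "norm w \<le> norm (fst w) + norm (snd w)"
        by (metis norm_Pair_le prod.collapse)
      then have "norm (fst w) \<ge> exp r \<or> norm (snd w) \<ge> exp r" using that by linarith
      then show ?thesis using F_const[of "fst w" "snd w"] by auto
    qed
    show "(K \<circ> F) w = 0 \<longleftrightarrow> w = (1, 1)" for w
      using injK K(1) F_zero by (metis comp_apply injD linear_0)
    show "((K \<circ> F) has_derivative (\<lambda>u. u)) (at (1, 1))"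
      using bounded_linear.has_derivative[OF blK derF] K(2)[unfolded o_def M_def id_def]
      by (simp add: o_def)
  qed
qed

text \<open>Beyond \<open>\<bar>p\<bar> = R\<close> the first component may be moved to a nonzero constant without creating zeros,
  since the second one does not vanish there; after that the second component may be cut off.\<close>

theorem unique_regular_zero_impossible:
  fixes G :: "(real^2) \<times> (real^2) \<Rightarrow> (real^2) \<times> (real^2)"
  assumes cont: "continuous_on UNIV G"
    and per: "\<And>x n p. (\<forall>i. n $ i \<in> \<int>) \<Longrightarrow> G (x + n, p) = G (x, p)"
    and outer: "\<And>x p. norm p \<ge> R \<Longrightarrow> snd (G (x, p)) \<noteq> 0"
    and zero: "G z0 = 0"
    and uniq: "\<And>z. G z = 0 \<Longrightarrow> snd z = snd z0 \<and> (\<forall>i. fst z $ i - fst z0 $ i \<in> \<int>)"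
    and der: "(G has_derivative L) (at z0)" and inj: "inj L"
  shows False
proof -
  \<comment> \<open>\<open>s\<close> rises from 0 to 1 between the radii \<open>R\<close> and
    \<open>R + 1\<close>, and \<open>b\<close> falls from 1 to 0 between \<open>R + 1\<close> and
    \<open>R + 2\<close>. The two deformations thus take place on separate shells.\<close>
  define s where "s = (\<lambda>p::real^2. max 0 (min 1 (norm p - R)))"
  define b where "b = (\<lambda>p::real^2. max 0 (min 1 (R + 2 - norm p)))"
  define c :: "real^2" where "c = axis 1 1"
  define H where "H = (\<lambda>z. (fst (G z) + s (snd z) *\<^sub>R (c - fst (G z)), b (snd z) *\<^sub>R snd (G z)))"
  have c: "c \<noteq> 0" by (simp add: c_def axis_eq_0_iff)
  have HG: "H z = G z" if "norm (snd z) \<le> R" for z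
    using that by (auto simp: H_def s_def b_def)
  have H0: "G z = 0" if "H z = 0" for z
  proof (cases "norm (snd z) \<le> R")
    case True
    then show ?thesis using that HG by simp
  next
    case False
    show ?thesis
    proof (cases "norm (snd z) \<le> R + 1")
      case True
      then have "b (snd z) = 1" by (auto simp: b_def)
      then have "snd (G z) = 0" using that by (simp add: H_def prod_eq_iff)
      then show ?thesis using outer[of "snd z" "fst z"] False by simp
    next
      case False
      then have "s (snd z) = 1" by (auto simp: s_def)
      then show ?thesis using that c by (simp add: H_def prod_eq_iff)
    qed
  qed
  \<comment> \<open>The strict inequality makes \<open>H\<close> and \<open>G\<close> agree near
    \<open>z0\<close>, so they have the same derivative there.\<close>
  have z0: "norm (snd z0) < R"
    using outer[of "snd z0" "fst z0"] zero by force
  show False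
  proof (rule periodic_zero_constant_end_impossible[of H "R + 2" "(c, 0)" z0 L])
    show "continuous_on UNIV H"
      unfolding H_def s_def b_def by (intro continuous_intros cont)
    show "H (x + n, p) = H (x, p)" if "\<forall>i. n $ i \<in> \<int>" for x n p
      using per[OF that] by (simp add: H_def)
    show "H (x, p) = (c, 0)" if "norm p \<ge> R + 2" for x p
      using that by (simp add: H_def s_def b_def)
    show "(c, 0) \<noteq> 0" using c by (simp add: zero_prod_def)
    show "H z0 = 0" using HG z0 zero by simp
    show "snd z = snd z0 \<and> (\<forall>i. fst z $ i - fst z0 $ i \<in> \<int>)" if "H z = 0" for z
      using H0[OF that] uniq by blast
    show "(H has_derivative L) (at z0)"
    proof (rule has_derivative_transform_within_open[OF der])
      show "open {z :: (real^2) \<times> (real^2). norm (snd z) < R}"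
        by (intro open_Collect_less continuous_intros)
    qed (use z0 HG in auto)
  qed (rule inj)
qed

section \<open>Ordinary differential equations\<close>

lemma DERIV_exp_linear: "((\<lambda>t. exp (c * t)) has_real_derivative c * exp (c * s)) (at s)"
  by (auto intro!: derivative_eq_intros)

text \<open>The squared norm, multiplied by \<open>exp (- 2 * K * t)\<close>, is nonincreasing.
  Squaring avoids the point where the norm is not differentiable.\<close>

lemma gronwall_inner:
  fixes D D' :: "real \<Rightarrow> 'a::real_inner"
  assumes D: "\<And>t. t \<in> {0..T} \<Longrightarrow> (D has_vector_derivative D' t) (at t)"
    and le: "\<And>t. t \<in> {0..T} \<Longrightarrow> norm (D' t) \<le> K * norm (D t)"
    and t: "t \<in> {0..T}"
  shows "norm (D t) \<le> norm (D 0) * exp (K * t)"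
proof -
  define g where "g = (\<lambda>t. (D t \<bullet> D t) * exp (- 2 * K * t))"
  have der: "(g has_real_derivative (2 * (D s \<bullet> D' s) - 2 * K * (D s \<bullet> D s)) * exp (- 2 * K * s)) (at s)"
    if "s \<in> {0..T}" for s
  proof -
    have "((\<lambda>t. D t \<bullet> D t) has_real_derivative 2 * (D s \<bullet> D' s)) (at s)"
      using has_derivative_inner[OF D[OF that, unfolded has_vector_derivative_def] D[OF that, unfolded has_vector_derivative_def]]
      unfolding has_field_derivative_def
      by (rule has_derivative_eq_rhs) (simp add: inner_commute algebra_simps fun_eq_iff)
    from DERIV_mult[OF this DERIV_exp_linear[of "- 2 * K"]]
    show "(g has_real_derivative (2 * (D s \<bullet> D' s) - 2 * K * (D s \<bullet> D s)) * exp (- 2 * K * s)) (at s)"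
      unfolding g_def by (rule DERIV_cong) (simp add: algebra_simps)
  qed
  have "g t \<le> g 0"
  proof (rule DERIV_nonpos_imp_nonincreasing[of 0 t g])
    show "0 \<le> t" using t by simp
    fix s assume "0 \<le> s" "s \<le> t"
    then have s: "s \<in> {0..T}" using t by simp
    have "D s \<bullet> D' s \<le> norm (D s) * norm (D' s)"
      by (rule norm_cauchy_schwarz)
    also have "\<dots> \<le> norm (D s) * (K * norm (D s))"
      using le[OF s] by (intro mult_left_mono) auto
    finally have "2 * (D s \<bullet> D' s) - 2 * K * (D s \<bullet> D s) \<le> 0"
      by (simp add: power2_norm_eq_inner[symmetric] power2_eq_square mult.left_commute)
    then show "\<exists>y. (g has_real_derivative y) (at s) \<and> y \<le> 0"
      using der[OF s] by (metis exp_ge_zero mult_nonpos_nonneg)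
  qed
  then have "(norm (D t))\<^sup>2 * exp (- 2 * K * t) \<le> (norm (D 0))\<^sup>2"
    by (simp add: g_def power2_norm_eq_inner)
  then have "(norm (D t))\<^sup>2 * exp (- 2 * K * t) * exp (2 * K * t) \<le> (norm (D 0))\<^sup>2 * exp (2 * K * t)"
    by (intro mult_right_mono) auto
  then have "(norm (D t))\<^sup>2 \<le> (norm (D 0) * exp (K * t))\<^sup>2"
    by (simp add: mult.assoc exp_add[symmetric] power_mult_distrib exp_double[symmetric])
  then show ?thesis
    by (rule power2_le_imp_le) simp
qed

text \<open>The mean value inequality with a majorant; negative times follow by reflection. A
  general majorant \<phi> serves both the exponential weight of the Picard operator and the linear
  bound in the rotating frame.\<close>

lemma norm_le_of_vector_derivative_bound:
  fixes I u :: "real \<Rightarrow> 'a::real_normed_vector" and \<phi> \<phi>' :: "real \<Rightarrow> real"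
  assumes I: "\<And>t. (I has_vector_derivative u t) (at t)" "I 0 = 0"
    and \<phi>: "\<And>t. (\<phi> has_real_derivative \<phi>' t) (at t)"
    and le: "\<And>t. norm (u t) \<le> \<phi>' \<bar>t\<bar>"
  shows "norm (I t) \<le> \<phi> \<bar>t\<bar> - \<phi> 0"
proof -
  have main: "norm (J s) \<le> \<phi> s - \<phi> 0"
    if J: "\<And>t. (J has_vector_derivative v t) (at t)" "J 0 = 0" "\<And>t. norm (v t) \<le> \<phi>' \<bar>t\<bar>" and s: "s \<ge> 0"
    for J v :: "real \<Rightarrow> 'a" and s
  proof (cases "s = 0")
    case False
    have "norm (J s - J 0) \<le> \<phi> s - \<phi> 0"
    proof (rule differentiable_bound_general)
      show "0 < s" using s False by simp
      show "continuous_on {0..s} J"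
        using J(1) by (meson continuous_at_imp_continuous_on has_vector_derivative_continuous)
      show "continuous_on {0..s} \<phi>"
        using \<phi> by (meson continuous_at_imp_continuous_on DERIV_isCont)
      fix t assume "0 < t" "t < s"
      show "(J has_vector_derivative v t) (at t)" by (rule J)
      show "(\<phi> has_vector_derivative \<phi>' t) (at t)"
        using \<phi> by (simp add: has_real_derivative_iff_has_vector_derivative)
      show "norm (v t) \<le> \<phi>' t" using J(3)[of t] \<open>0 < t\<close> by simp
    qed
    then show ?thesis using J by simp
  qed (use J in simp)
  show ?thesis
  proof (cases "t \<ge> 0")
    case True
    then show ?thesis using main[of I u t] assms by simp
  next
    case False
    have "norm ((\<lambda>s. I (- s)) (- t)) \<le> \<phi> (- t) - \<phi> 0"
    proof (rule main)
      show "((\<lambda>s. I (- s)) has_vector_derivative - u (- r)) (at r)" for r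
      proof -
        have "((\<lambda>s::real. - s) has_vector_derivative - 1) (at r)"
          by (auto intro!: derivative_eq_intros)
        from vector_diff_chain_at[OF this, of I "u (-r)"] show ?thesis
          using I(1)[of "-r"] by (simp add: o_def)
      qed
    qed (use assms(2) le[of "- _"] False in auto)
    then show ?thesis using False by simp
  qed
qed

lemma antiderivative_exists:
  fixes u :: "real \<Rightarrow> 'a::euclidean_space"
  assumes "continuous_on UNIV u"
  obtains I where "\<And>t. (I has_vector_derivative u t) (at t)" "I 0 = 0"
proof -
  have "isCont u x" for x
    using assms by (simp add: continuous_on_eq_continuous_at)
  then obtain F where F: "\<And>x. (F has_vector_derivative u x) (at x)"
    using einterval_antiderivative[of "-\<infinity>" "\<infinity>" u] by auto
  show ?thesis
    by (rule that[of "\<lambda>x. F x - F 0"]) (auto intro!: derivative_eq_intros F)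
qed

text \<open>Banach's fixed point theorem for \<open>u t = exp (- k \<bar>t\<bar>) *\<^sub>R y t\<close>, where \<open>k' = 2 K\<close>: this weight
  makes the Picard operator a contraction on all of \<open>\<real>\<close>.\<close>

theorem global_solution_exists:
  fixes f :: "real \<Rightarrow> 'a::euclidean_space \<Rightarrow> 'a"
  assumes cont: "continuous_on UNIV (\<lambda>(t, x). f t x)"
    and lip: "\<And>t x y. norm (f t x - f t y) \<le> (A + B * \<bar>t\<bar>) * norm (x - y)"
    and bdd: "\<And>t. norm (f t 0) \<le> A + B * \<bar>t\<bar>"
  obtains y where "y 0 = z" "\<And>t. (y has_vector_derivative f t (y t)) (at t)"
proof -
  define k where "k = (\<lambda>t::real. 2 * A * t + B * t\<^sup>2)"
  define K where "K = (\<lambda>t. A + B * t)"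
  define e where "e = (\<lambda>t. exp (k \<bar>t\<bar>))"
  \<comment> \<open>The weight reproduces itself under integration against the Lipschitz constant
    \<open>K\<close>, up to the factor 1/2 that becomes the contraction constant.\<close>
  have der: "((\<lambda>t. exp (k t) / 2) has_real_derivative K t * exp (k t)) (at t)" for t
    unfolding k_def K_def by (auto intro!: derivative_eq_intros simp: algebra_simps)
  have K0: "K \<bar>t\<bar> \<ge> 0" for t
    using order_trans[OF norm_ge_zero bdd[of t]] by (simp add: K_def)
  have A0: "A \<ge> 0" using K0[of 0] by (simp add: K_def)
  have e0: "e 0 = 1" by (simp add: e_def k_def)
  have epos: "e t > 0" for t by (simp add: e_def)
  have k0: "k \<bar>t\<bar> \<ge> 0" for t
  proof -
    have "k \<bar>t\<bar> = A * \<bar>t\<bar> + K \<bar>t\<bar> * \<bar>t\<bar>"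
      by (simp add: k_def K_def power2_eq_square algebra_simps)
    then show ?thesis using A0 K0 by simp
  qed
  have e1: "e t \<ge> 1" for t using k0 by (simp add: e_def)
  have cont_e: "continuous_on UNIV e"
    unfolding e_def k_def by (intro continuous_intros)
  \<comment> \<open>The Picard integrand, with the weight removed from the bounded unknown.\<close>
  define src where "src = (\<lambda>(u :: real \<Rightarrow>\<^sub>C 'a) s. f s (e s *\<^sub>R apply_bcontfun u s))"
  have cont_src: "continuous_on UNIV (src u)" for u
  proof -
    have "continuous_on UNIV (\<lambda>s. (s, e s *\<^sub>R apply_bcontfun u s))"
      by (intro continuous_intros cont_e continuous_on_apply_bcontfun)
    from continuous_on_compose2[OF cont this] show ?thesis by (simp add: src_def)
  qed
  define P where "P = (\<lambda>u. SOME I. (\<forall>t. (I has_vector_derivative src u t) (at t)) \<and> I 0 = 0)"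
  have P: "(P u has_vector_derivative src u t) (at t)" "P u 0 = 0" for u t
  proof -
    have "\<exists>I. (\<forall>t. (I has_vector_derivative src u t) (at t)) \<and> I 0 = 0"
      by (metis antiderivative_exists[OF cont_src])
    then have "(\<forall>t. (P u has_vector_derivative src u t) (at t)) \<and> P u 0 = 0"
      unfolding P_def by (rule someI_ex)
    then show "(P u has_vector_derivative src u t) (at t)" "P u 0 = 0" by auto
  qed
  have cont_P: "continuous_on UNIV (P u)" for u
    using P(1) by (meson continuous_at_imp_continuous_on has_vector_derivative_continuous)
  \<comment> \<open>The inhomogeneous term \<open>f s 0\<close> is absorbed into the weight because
    \<open>e s\<close> is at least 1.\<close>
  have src_bound: "norm (src u s) \<le> (1 + norm u) * (K \<bar>s\<bar> * exp (k \<bar>s\<bar>))" for u s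
  proof -
    have "norm (src u s) \<le> norm (f s 0) + norm (src u s - f s 0)"
      by (metis add.commute diff_add_cancel norm_triangle_ineq)
    also have "\<dots> \<le> K \<bar>s\<bar> + K \<bar>s\<bar> * norm (e s *\<^sub>R apply_bcontfun u s - 0)"
      unfolding src_def K_def by (intro add_mono bdd lip)
    also have "\<dots> \<le> K \<bar>s\<bar> * e s + K \<bar>s\<bar> * (e s * norm u)"
      using K0[of s] e1[of s] epos[of s] norm_bounded[of u s]
      by (intro add_mono mult_left_mono) (auto intro!: mult_left_mono simp: mult_le_cancel_left1)
    finally show ?thesis by (simp add: e_def algebra_simps)
  qed
  have P_bound: "norm (P u t) \<le> (1 + norm u) * e t" for u t
  proof -
    have "norm (P u t) \<le> (1 + norm u) * (exp (k \<bar>t\<bar>) / 2) - (1 + norm u) * (exp (k 0) / 2)"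
      by (rule norm_le_of_vector_derivative_bound[OF P DERIV_cmult[OF der] src_bound])
    also have "\<dots> \<le> (1 + norm u) * e t"
    proof -
      have "(1 + norm u) * (exp (k \<bar>t\<bar>) / 2) - (1 + norm u) * (exp (k 0) / 2)
        = (1 + norm u) * (e t / 2 - exp (k 0) / 2)"
        by (simp add: e_def algebra_simps)
      also have "\<dots> \<le> (1 + norm u) * e t"
        using epos[of t] exp_gt_zero[of "k 0"] norm_ge_zero[of u] by (intro mult_left_mono; linarith)
      finally show ?thesis .
    qed
    finally show ?thesis .
  qed
  \<comment> \<open>Dividing by the weight returns the Picard iterate to the space of bounded
    continuous functions.\<close>
  define F where "F = (\<lambda>u. Bcontfun (\<lambda>t. (1 / e t) *\<^sub>R (z + P u t)))"
  have F: "apply_bcontfun (F u) t = (1 / e t) *\<^sub>R (z + P u t)" for u t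
  proof -
    have "(\<lambda>t. (1 / e t) *\<^sub>R (z + P u t)) \<in> bcontfun"
    proof (rule bcontfun_normI)
      show "continuous_on UNIV (\<lambda>t. (1 / e t) *\<^sub>R (z + P u t))"
        using less_imp_neq[OF epos, THEN not_sym] by (intro continuous_intros cont_e cont_P) auto
      fix t
      have "norm (z + P u t) \<le> norm z * e t + (1 + norm u) * e t"
        using e1[of t] by (intro norm_triangle_le add_mono P_bound) (simp add: mult_le_cancel_left1)
      then have "norm (z + P u t) / e t \<le> norm z + (1 + norm u)"
        using epos[of t] by (subst pos_divide_le_eq) (auto simp: distrib_right)
      moreover have "norm ((1 / e t) *\<^sub>R (z + P u t)) = norm (z + P u t) / e t"
        using epos[of t] by (simp del: scaleR_add_right)
      ultimately show "norm ((1 / e t) *\<^sub>R (z + P u t)) \<le> norm z + (1 + norm u)"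
        by (simp only:)
    qed
    then show ?thesis by (simp add: F_def Bcontfun_inverse)
  qed
  have "dist (F u) (F v) \<le> 1/2 * dist u v" for u v
  proof (rule dist_bound)
    fix t
    have "norm (P u t - P v t) \<le> dist u v * (exp (k \<bar>t\<bar>) / 2) - dist u v * (exp (k 0) / 2)"
    proof (rule norm_le_of_vector_derivative_bound[where u="\<lambda>s. src u s - src v s"])
      show "((\<lambda>t. P u t - P v t) has_vector_derivative src u t - src v t) (at t)" for t
        by (rule has_vector_derivative_diff[OF P(1) P(1)])
      show "((\<lambda>t. dist u v * (exp (k t) / 2)) has_real_derivative dist u v * (K t * exp (k t))) (at t)" for t
        by (rule DERIV_cmult[OF der])
      fix s
      have "norm (src u s - src v s) \<le> K \<bar>s\<bar> * norm (e s *\<^sub>R apply_bcontfun u s - e s *\<^sub>R apply_bcontfun v s)"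
        unfolding src_def K_def by (rule lip)
      also have "\<dots> = K \<bar>s\<bar> * (e s * dist (apply_bcontfun u s) (apply_bcontfun v s))"
        using epos[of s] by (simp only: dist_norm scaleR_diff_right[symmetric] norm_scaleR abs_of_pos)
      also have "\<dots> \<le> K \<bar>s\<bar> * (e s * dist u v)"
        using K0 epos[of s] by (intro mult_left_mono dist_bounded) auto
      finally show "norm (src u s - src v s) \<le> dist u v * (K \<bar>s\<bar> * exp (k \<bar>s\<bar>))"
        by (simp add: e_def mult.commute mult.left_commute)
    qed (simp add: P)
    also have "\<dots> \<le> dist u v * (e t / 2)"
      by (simp add: e_def)
    finally have "norm (P u t - P v t) / e t \<le> 1/2 * dist u v"
      using epos[of t] by (subst pos_divide_le_eq) auto
    moreover have "apply_bcontfun (F u) t - apply_bcontfun (F v) t = (1 / e t) *\<^sub>R (P u t - P v t)"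
      by (simp add: F algebra_simps)
    ultimately show "dist (apply_bcontfun (F u) t) (apply_bcontfun (F v) t) \<le> 1/2 * dist u v"
      using epos[of t] by (simp only: dist_norm norm_scaleR) simp
  qed
  then obtain u where u: "F u = u"
    using banach_fix_type[of "1/2" F] by auto
  define y where "y = (\<lambda>t. e t *\<^sub>R apply_bcontfun u t)"
  have y: "y t = z + P u t" for t
  proof -
    have "y t = e t *\<^sub>R apply_bcontfun (F u) t" by (simp add: y_def u)
    also have "\<dots> = z + P u t" using epos[of t] by (simp only: F) simp
    finally show ?thesis .
  qed
  show ?thesis
  proof (rule that[of y])
    show "y 0 = z" by (simp add: y P)
    fix t
    have "((\<lambda>t. z + P u t) has_vector_derivative 0 + src u t) (at t)"
      by (rule has_vector_derivative_add[OF has_vector_derivative_const P(1)])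
    moreover have "src u t = f t (y t)" by (simp add: src_def y_def)
    ultimately have "((\<lambda>t. z + P u t) has_vector_derivative f t (y t)) (at t)"
      by simp
    moreover have "y = (\<lambda>t. z + P u t)" using y by (rule ext)
    ultimately show "(y has_vector_derivative f t (y t)) (at t)"
      by (rule arg_cong[where f="\<lambda>g. (g has_vector_derivative f t (y t)) (at t)", THEN iffD2, rotated])
  qed
qed

section \<open>Smooth maps\<close>

lemma times_cont_differentiable_SucD:
  "times_cont_differentiable (Suc n) f \<Longrightarrow> times_cont_differentiable n f"
proof (induction n arbitrary: f)
  case 0
  then show ?case by (simp add: differentiable_imp_continuous_on)
qed auto

lemma times_cont_differentiable_SucI:
  assumes "\<And>x. (f has_derivative f' x) (at x)"
    and "\<And>v. times_cont_differentiable n (\<lambda>x. f' x v)"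
  shows "times_cont_differentiable (Suc n) f"
  using assms frechet_derivative_at[OF assms(1)]
  by (auto simp: differentiable_on_def differentiable_def dest: sym)

lemma times_cont_differentiable_SucD_derivative:
  assumes "times_cont_differentiable (Suc n) f"
  shows "(f has_derivative frechet_derivative f (at x)) (at x)"
  using assms by (simp add: frechet_derivative_works differentiable_on_def)

lemma times_cont_differentiable_const: "times_cont_differentiable n (\<lambda>x. c)"
  by (induction n arbitrary: c) (auto intro!: times_cont_differentiable_SucI derivative_eq_intros simp del: times_cont_differentiable.simps(2))

lemma times_cont_differentiable_bounded_linear:
  assumes "bounded_linear L"
  shows "times_cont_differentiable n L"
proof (cases n)
  case 0
  then show ?thesis using assms by (simp add: linear_continuous_on)
next
  case (Suc m)
  show ?thesis unfolding Suc
    by (rule times_cont_differentiable_SucI[where f'="\<lambda>x. L"])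
      (auto intro: bounded_linear_imp_has_derivative assms times_cont_differentiable_const)
qed

lemma times_cont_differentiable_add:
  assumes "times_cont_differentiable n f" "times_cont_differentiable n g"
  shows "times_cont_differentiable n (\<lambda>x. f x + g x)"
  using assms
proof (induction n arbitrary: f g)
  case 0
  then show ?case by (auto intro: continuous_on_add)
next
  case (Suc n)
  show ?case
    by (rule times_cont_differentiable_SucI[OF has_derivative_add[OF
          Suc.prems[THEN times_cont_differentiable_SucD_derivative]]])
       (use Suc in auto)
qed

lemma times_cont_differentiable_sum:
  assumes "\<And>i. i \<in> I \<Longrightarrow> times_cont_differentiable n (f i)"
  shows "times_cont_differentiable n (\<lambda>x. \<Sum>i\<in>I. f i x)"
  using assms
  by (induction I rule: infinite_finite_induct)
    (auto intro: times_cont_differentiable_const times_cont_differentiable_add)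

text \<open>By the product rule each term of the derivative has one differentiated factor; the other
  factor is brought down to order \<open>n\<close>, so that the induction hypothesis covers
  both.\<close>

lemma times_cont_differentiable_bilinear:
  assumes bl: "bounded_bilinear B"
    and "times_cont_differentiable n f" "times_cont_differentiable n g"
  shows "times_cont_differentiable n (\<lambda>x. B (f x) (g x))"
  using assms(2,3)
proof (induction n arbitrary: f g)
  case 0
  then show ?case using bounded_bilinear.continuous_on[OF bl] by auto
next
  case (Suc n)
  show ?case
    by (rule times_cont_differentiable_SucI[OF bounded_bilinear.FDERIV[OF bl
          Suc.prems[THEN times_cont_differentiable_SucD_derivative]]])
       (use Suc.prems in \<open>auto intro!: times_cont_differentiable_add Suc.IH
          times_cont_differentiable_SucD[OF Suc.prems(1)] times_cont_differentiable_SucD[OF Suc.prems(2)]\<close>)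
qed

text \<open>The definition controls derivatives only in fixed directions, while the chain rule
  yields a direction that depends on \<open>x\<close>. Expanding it in \<open>Basis\<close> leaves
  products of scalar functions with derivatives of \<open>g\<close> in fixed directions.\<close>

lemma times_cont_differentiable_compose:
  fixes f :: "'a::real_normed_vector \<Rightarrow> 'b::euclidean_space" and g :: "'b \<Rightarrow> 'c::real_normed_vector"
  assumes "times_cont_differentiable n g" "times_cont_differentiable n f"
  shows "times_cont_differentiable n (\<lambda>x. g (f x))"
  using assms
proof (induction n arbitrary: g)
  case 0
  then show ?case by (auto intro: continuous_on_compose2)
next
  case (Suc n)
  let ?f' = "\<lambda>x. frechet_derivative f (at x)" and ?g' = "\<lambda>y. frechet_derivative g (at y)"
  note f' = times_cont_differentiable_SucD_derivative[OF Suc.prems(2)]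
  note g' = times_cont_differentiable_SucD_derivative[OF Suc.prems(1)]
  have expand: "?g' (f x) (?f' x v) = (\<Sum>b\<in>Basis. (?f' x v \<bullet> b) *\<^sub>R ?g' (f x) b)" for x v
  proof -
    interpret linear "?g' (f x)" using g' has_derivative_linear by blast
    have "?g' (f x) (?f' x v) = ?g' (f x) (\<Sum>b\<in>Basis. (?f' x v \<bullet> b) *\<^sub>R b)"
      by (simp only: euclidean_representation)
    then show ?thesis by (simp add: sum scale)
  qed
  show ?case
  proof (rule times_cont_differentiable_SucI[OF has_derivative_compose[OF f' g']])
    fix v
    have f: "times_cont_differentiable n f" by (rule times_cont_differentiable_SucD[OF Suc.prems(2)])
    have "times_cont_differentiable n (\<lambda>x. \<Sum>b\<in>Basis. (?f' x v \<bullet> b) *\<^sub>R ?g' (f x) b)"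
    proof (rule times_cont_differentiable_sum)
      fix b :: 'b assume "b \<in> Basis"
      show "times_cont_differentiable n (\<lambda>x. (?f' x v \<bullet> b) *\<^sub>R ?g' (f x) b)"
        using Suc.prems f
        by (auto intro!: times_cont_differentiable_bilinear[OF bounded_bilinear_scaleR]
              times_cont_differentiable_bilinear[OF bounded_bilinear_inner] times_cont_differentiable_const Suc.IH)
    qed
    then show "times_cont_differentiable n (\<lambda>x. ?g' (f x) (?f' x v))"
      by (simp only: expand)
  qed
qed

lemma times_cont_differentiable_Pair:
  assumes "times_cont_differentiable n f" "times_cont_differentiable n g"
  shows "times_cont_differentiable n (\<lambda>x. (f x, g x))"
  using assms
proof (induction n arbitrary: f g)
  case 0
  then show ?case by (auto intro: continuous_on_Pair)
next
  case (Suc n)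
  show ?case
    by (rule times_cont_differentiable_SucI[OF has_derivative_Pair[OF
          Suc.prems[THEN times_cont_differentiable_SucD_derivative]]])
       (use Suc in auto)
qed

lemmas times_cont_differentiable_linear_image =
  times_cont_differentiable_compose[OF times_cont_differentiable_bounded_linear]

lemma smooth_imp_differentiable:
  "smooth f \<Longrightarrow> (f has_derivative frechet_derivative f (at x)) (at x)"
  unfolding smooth_def using times_cont_differentiable_SucD_derivative by blast

lemma smooth_frechet_derivative:
  "smooth f \<Longrightarrow> smooth (\<lambda>x. frechet_derivative f (at x) v)"
  unfolding smooth_def by (metis times_cont_differentiable.simps(2))

lemma smooth_imp_continuous_on: "smooth f \<Longrightarrow> continuous_on S f"
  unfolding smooth_def by (metis times_cont_differentiable.simps(1) continuous_on_subset subset_UNIV)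

lemma times_cont_differentiable_vec_lambda:
  fixes f :: "'i::finite \<Rightarrow> 'a::real_normed_vector \<Rightarrow> real"
  assumes "\<And>i. times_cont_differentiable n (f i)"
  shows "times_cont_differentiable n (\<lambda>x. \<chi> i. f i x)"
proof -
  have "(\<lambda>x. \<chi> i. f i x) = (\<lambda>x. \<Sum>i\<in>UNIV. f i x *\<^sub>R axis i 1)"
  proof
    show "(\<chi> i. f i x) = (\<Sum>i\<in>UNIV. f i x *\<^sub>R axis i 1)" for x
      using basis_expansion[of "\<chi> i. f i x"] by (simp add: scalar_mult_eq_scaleR)
  qed
  then show ?thesis
    by (simp only:) (intro times_cont_differentiable_sum
        times_cont_differentiable_bilinear[OF bounded_bilinear_scaleR] times_cont_differentiable_const assms)
qed

section \<open>The magnetic flow on the universal cover\<close>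

lemma torus_proj_eq_iff: "torus_proj x = torus_proj y \<longleftrightarrow> (\<forall>i. x $ i - y $ i \<in> \<int>)"
  by transfer (simp add: lattice_equiv_def)

lemma torus_proj_add_lattice: "(\<forall>i. n $ i \<in> \<int>) \<Longrightarrow> torus_proj (x + n) = torus_proj x"
  by (simp add: torus_proj_eq_iff)

lemma torus_translate_proj: "torus_translate (torus_proj x) v = torus_proj (x + v)"
  by transfer (simp add: lattice_equiv_def)

lemma cotangent_proj_eq_iff:
  "cotangent_proj z = cotangent_proj z' \<longleftrightarrow> snd z = snd z' \<and> (\<forall>i. fst z $ i - fst z' $ i \<in> \<int>)"
  by (auto simp: cotangent_proj_def torus_proj_eq_iff)

lemma cotangent_translate_proj: "cotangent_translate (cotangent_proj z) u = cotangent_proj (z + u)"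
  by (simp add: cotangent_translate_def cotangent_proj_def torus_translate_proj)

definition rot90 :: "real^2 \<Rightarrow> real^2" where
  "rot90 p = vector [- p $ 2, p $ 1]"

lemma rot90_nth [simp]: "rot90 p $ 1 = - p $ 2" "rot90 p $ 2 = p $ 1"
  by (simp_all add: rot90_def)

lemma bounded_linear_rot90: "bounded_linear rot90"
proof -
  have "linear rot90"
    by (rule linearI) (auto simp: vec_eq_iff forall_2)
  then show ?thesis by (simp add: linear_conv_bounded_linear)
qed

lemma norm_rot90 [simp]: "norm (rot90 p) = norm p"
  by (simp add: norm_eq_sqrt_inner inner_vec_def sum_2)

lemma area_form_eq: "area_form q u v = rot90 u \<bullet> v"
  by (simp add: area_form_def inner_vec_def sum_2)

lemma has_derivative_imp_frechet_derivative:
  "(f has_derivative f') (at x) \<Longrightarrow> frechet_derivative f (at x) = f'"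
  using frechet_derivative_at by force

text \<open>The Liouville form is linear in the momentum and independent of the base point, so only
  the vertical component of the direction contributes to its differential.\<close>

lemma magnetic_form_eq:
  "magnetic_form \<sigma> z u v = snd u \<bullet> fst v - snd v \<bullet> fst u + \<sigma> (fst z) (fst u) (fst v)"
proof -
  have "cotangent_differential (\<lambda>y. liouville_form y v) z u = snd u \<bullet> fst v" for u v
  proof -
    have "((\<lambda>u::tangent. (snd z + snd u) \<bullet> fst v) has_derivative (\<lambda>u. snd u \<bullet> fst v)) (at 0)"
      by (auto intro!: derivative_eq_intros)
    from has_derivative_imp_frechet_derivative[OF this] show ?thesis
      by (simp add: cotangent_differential_def liouville_form_def cotangent_translate_def)
  qed
  then show ?thesis
    by (simp add: magnetic_form_def exterior_derivative_def)
qed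

section \<open>Functions periodic in time and space\<close>

definition torus_periodic :: "real \<Rightarrow> (real \<times> (real^2) \<Rightarrow> 'b) \<Rightarrow> bool" where
  "torus_periodic \<tau> g \<longleftrightarrow> (\<forall>t x. g (t + \<tau>, x) = g (t, x)) \<and>
     (\<forall>t x n. (\<forall>i. n $ i \<in> \<int>) \<longrightarrow> g (t, x + n) = g (t, x))"

text \<open>All values already occur on a compact fundamental domain, a time interval times the unit
  square.\<close>

lemma torus_periodic_bounded:
  fixes g :: "real \<times> (real^2) \<Rightarrow> 'b::real_normed_vector"
  assumes "\<tau> > 0" "torus_periodic \<tau> g" "continuous_on UNIV g"
  shows "\<exists>C. \<forall>z. norm (g z) \<le> C"
proof -
  define S where "S = {0..\<tau>} \<times> cbox 0 (1 :: real^2)"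
  have "compact (g ` S)"
    unfolding S_def
    by (intro compact_continuous_image compact_Times compact_cbox compact_Icc)
      (use assms(3) continuous_on_subset in blast)
  then obtain C where C: "\<And>z. z \<in> S \<Longrightarrow> norm (g z) \<le> C"
    using compact_imp_bounded bounded_iff by (metis imageI)
  have per: "g (t + \<tau>, x) = g (t, x)" for t x
    using assms(2) by (simp add: torus_periodic_def)
  have shift: "g (t + of_int k * \<tau>, x) = g (t, x)" for t x and k :: int
  proof (induction k rule: int_induct[where k=0])
    case (step1 i)
    have "t + of_int (i + 1) * \<tau> = t + of_int i * \<tau> + \<tau>" by (simp add: algebra_simps)
    then show ?case by (simp only: per step1)
  next
    case (step2 i)
    have "t + of_int i * \<tau> = t + of_int (i - 1) * \<tau> + \<tau>" by (simp add: algebra_simps)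
    then show ?case using step2 by (simp only: per)
  qed simp
  have "norm (g (t, x)) \<le> C" for t x
  proof -
    define k where "k = - \<lfloor>t / \<tau>\<rfloor>"
    define n :: "real^2" where "n = (\<chi> i. - of_int \<lfloor>x $ i\<rfloor>)"
    have "t + of_int k * \<tau> = frac (t / \<tau>) * \<tau>"
      using assms(1) by (simp add: k_def frac_def field_simps)
    then have "t + of_int k * \<tau> \<in> {0..\<tau>}"
      using assms(1) frac_lt_1[of "t / \<tau>"] by (simp add: mult_le_cancel_right1)
    moreover have "x + n \<in> cbox 0 1"
      by (auto simp: mem_box_cart n_def) (linarith+)
    ultimately have "norm (g (t + of_int k * \<tau>, x + n)) \<le> C"
      by (intro C) (auto simp: S_def)
    moreover have "g (t, x + n) = g (t, x)"
      using assms(2) unfolding torus_periodic_def by (simp add: n_def)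
    ultimately show ?thesis using shift by simp
  qed
  then show ?thesis by (metis surj_pair)
qed

lemma frechet_derivative_translation_invariant:
  assumes "\<And>z. g (z + c) = g z" "g differentiable (at (z + c))"
  shows "frechet_derivative g (at (z + c)) = frechet_derivative g (at z)"
proof -
  have "((\<lambda>z. g (z + c)) has_derivative (\<lambda>v. frechet_derivative g (at (z + c)) v)) (at z)"
    by (rule has_derivative_compose[of "\<lambda>z. z + c" "\<lambda>v. v"])
      (use assms(2) in \<open>auto intro!: derivative_eq_intros simp: frechet_derivative_works\<close>)
  then have "(g has_derivative frechet_derivative g (at (z + c))) (at z)"
    by (simp add: assms(1))
  then show ?thesis by (simp add: has_derivative_imp_frechet_derivative)
qed

lemma torus_periodic_frechet_derivative:
  fixes g :: "real \<times> (real^2) \<Rightarrow> 'b::real_normed_vector"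
  assumes "torus_periodic \<tau> g" "smooth g"
  shows "torus_periodic \<tau> (\<lambda>z. frechet_derivative g (at z) v)"
proof -
  have d: "g differentiable (at z)" for z
    using smooth_imp_differentiable[OF assms(2)] differentiable_def by blast
  have "frechet_derivative g (at ((t, x) + (\<tau>, 0))) = frechet_derivative g (at (t, x))" for t x
    using assms(1) by (intro frechet_derivative_translation_invariant d) (auto simp: torus_periodic_def)
  moreover have "frechet_derivative g (at ((t, x) + (0, n))) = frechet_derivative g (at (t, x))"
    if "\<forall>i. n $ i \<in> \<int>" for t x n
    using assms(1) that by (intro frechet_derivative_translation_invariant d) (auto simp: torus_periodic_def)
  ultimately show ?thesis by (simp add: torus_periodic_def)
qed

lemma has_derivative_space:
  fixes g :: "real \<times> (real^2) \<Rightarrow> real"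
  assumes "smooth g"
  shows "((\<lambda>x. g (t, x)) has_derivative
    (\<lambda>v. (\<chi> i. frechet_derivative g (at (t, x)) (0, axis i 1)) \<bullet> v)) (at x)"
proof -
  let ?D = "frechet_derivative g (at (t, x))"
  note D = smooth_imp_differentiable[OF assms, of "(t, x)"]
  have "((\<lambda>x. g (t, x)) has_derivative (\<lambda>v. ?D (0, v))) (at x)"
    using has_derivative_compose[where f="\<lambda>x. (t, x)" and g=g,
        OF has_derivative_Pair[OF has_derivative_const has_derivative_ident] D] by simp
  moreover have "?D (0, v) = (\<chi> i. ?D (0, axis i 1)) \<bullet> v" for v
  proof -
    interpret linear ?D by (rule has_derivative_linear[OF D])
    have "?D (0, v) = ?D ((v $ 1) *\<^sub>R (0, axis 1 1) + (v $ 2) *\<^sub>R (0, axis 2 1))"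
      by (rule arg_cong[where f="?D"]) (simp add: vec_eq_iff forall_2 axis_def)
    also have "\<dots> = (v $ 1) *\<^sub>R ?D (0, axis 1 1) + (v $ 2) *\<^sub>R ?D (0, axis 2 1)"
      by (simp only: add scale)
    finally show ?thesis by (simp add: inner_vec_def sum_2)
  qed
  ultimately show ?thesis by (rule has_derivative_eq_rhs[OF _ ext])
qed

text \<open>The spatial gradient inherits the periodicity and is therefore bounded; the mean value
  inequality gives a constant uniform in time.\<close>

lemma torus_periodic_lipschitz:
  fixes g :: "real \<times> (real^2) \<Rightarrow> real"
  assumes "\<tau> > 0" "torus_periodic \<tau> g" "smooth g"
  shows "\<exists>C. \<forall>t x y. \<bar>g (t, x) - g (t, y)\<bar> \<le> C * norm (x - y)"
proof -
  define G where "G = (\<lambda>z. \<chi> i. frechet_derivative g (at z) (0, axis i 1))"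
  have "torus_periodic \<tau> G"
    using torus_periodic_frechet_derivative[OF assms(2,3)]
    by (auto simp: G_def torus_periodic_def)
  moreover have "continuous_on UNIV G"
    unfolding G_def
    by (intro continuous_on_vec_lambda smooth_imp_continuous_on smooth_frechet_derivative assms)
  ultimately obtain C where C: "\<And>z. norm (G z) \<le> C"
    using torus_periodic_bounded[OF assms(1)] by blast
  have "norm (g (t, x) - g (t, y)) \<le> C * norm (x - y)" for t x y
  proof (rule differentiable_bound[of UNIV "\<lambda>x. g (t, x)" "\<lambda>x v. G (t, x) \<bullet> v"])
    show "((\<lambda>x. g (t, x)) has_derivative (\<lambda>v. G (t, x) \<bullet> v)) (at x)" for x
      unfolding G_def by (rule has_derivative_space[OF assms(3)])
    show "onorm (\<lambda>v. G (t, x) \<bullet> v) \<le> C" for x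
    proof (rule onorm_le)
      fix v
      have "norm (G (t, x) \<bullet> v) \<le> norm (G (t, x)) * norm v"
        using Cauchy_Schwarz_ineq2 by simp
      also have "\<dots> \<le> C * norm v" using C by (intro mult_right_mono) auto
      finally show "norm (G (t, x) \<bullet> v) \<le> C * norm v" .
    qed
  qed auto
  then show ?thesis by (auto simp: real_norm_def)
qed

lemma smooth_compose_snd:
  fixes f :: "real^2 \<Rightarrow> real"
  assumes "smooth f"
  shows "smooth (\<lambda>z :: real \<times> (real^2). f (snd z))"
  using assms times_cont_differentiable_compose[of _ f snd]
    times_cont_differentiable_bounded_linear[OF bounded_linear_snd]
  unfolding smooth_def by blast

section \<open>The rotating frame\<close>

definition complex_of_vec2 :: "real^2 \<Rightarrow> complex" where
  "complex_of_vec2 p = Complex (p $ 1) (p $ 2)"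

lemma bounded_linear_complex_of_vec2: "bounded_linear complex_of_vec2"
proof -
  have "linear complex_of_vec2"
    by (rule linearI) (auto simp: complex_of_vec2_def complex_eq_iff)
  then show ?thesis by (simp add: linear_conv_bounded_linear)
qed

lemma norm_complex_of_vec2 [simp]: "norm (complex_of_vec2 p) = norm p"
  by (simp add: complex_of_vec2_def cmod_def norm_eq_sqrt_inner inner_vec_def sum_2 power2_eq_square)

lemma complex_of_vec2_rot90: "complex_of_vec2 (rot90 p) = \<i> * complex_of_vec2 p"
  by (simp add: complex_of_vec2_def complex_eq_iff)

text \<open>In the frame rotating with angle \<open>\<theta>\<close> the magnetic force disappears.\<close>

lemma rotating_frame_bound:
  fixes p g :: "real \<Rightarrow> real^2" and b :: "real \<Rightarrow> real"
  assumes p: "\<And>t. (p has_vector_derivative - b t *\<^sub>R rot90 (p t) - g t) (at t)"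
    and b: "continuous_on UNIV b"
    and g: "\<And>t. norm (g t) \<le> C"
  obtains \<theta> where "\<theta> 0 = 0" "\<And>t. (\<theta> has_real_derivative b t) (at t)"
    "\<And>t. norm (cis (\<theta> t) * complex_of_vec2 (p t) - complex_of_vec2 (p 0)) \<le> C * \<bar>t\<bar>"
proof -
  obtain \<theta> where \<theta>: "\<And>t. (\<theta> has_vector_derivative b t) (at t)" "\<theta> 0 = 0"
    using antiderivative_exists[OF b] by metis
  define P where "P = (\<lambda>t. complex_of_vec2 (p t))"
  define Q where "Q = (\<lambda>t. cis (\<theta> t) * P t - P 0)"
  have P: "(P has_vector_derivative - b t *\<^sub>R (\<i> * P t) - complex_of_vec2 (g t)) (at t)" for t
    using bounded_linear.has_vector_derivative[OF bounded_linear_complex_of_vec2 p[of t]]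
      bounded_linear_complex_of_vec2
    by (simp add: P_def linear_simps complex_of_vec2_rot90)
  have cis: "((\<lambda>t. cis (\<theta> t)) has_vector_derivative b t *\<^sub>R (\<i> * cis (\<theta> t))) (at t)" for t
  proof -
    have "((\<lambda>t. \<i> * complex_of_real (\<theta> t)) has_vector_derivative \<i> * complex_of_real (b t)) (at t)"
      by (intro has_vector_derivative_mult_right bounded_linear.has_vector_derivative[OF bounded_linear_of_real] \<theta>)
    from field_vector_diff_chain_at[OF this DERIV_exp] show ?thesis
      by (simp add: o_def cis_conv_exp scaleR_conv_of_real mult_ac)
  qed
  \<comment> \<open>The derivative of the rotation cancels the magnetic term exactly; what remains
    is the rotated potential force, of norm at most \<open>C\<close>.\<close>
  have Q: "(Q has_vector_derivative - cis (\<theta> t) * complex_of_vec2 (g t)) (at t)" for t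
  proof -
    have "(Q has_vector_derivative (cis (\<theta> t) * (- b t *\<^sub>R (\<i> * P t) - complex_of_vec2 (g t))
       + b t *\<^sub>R (\<i> * cis (\<theta> t)) * P t) - 0) (at t)"
      unfolding Q_def
      by (intro has_vector_derivative_diff has_vector_derivative_mult cis P has_vector_derivative_const)
    then show ?thesis by (simp add: algebra_simps scaleR_conv_of_real)
  qed
  show ?thesis
  proof (rule that[of \<theta>])
    show "\<theta> 0 = 0" by (rule \<theta>)
    show "(\<theta> has_real_derivative b t) (at t)" for t
      using \<theta> by (simp add: has_real_derivative_iff_has_vector_derivative)
    have "norm (Q t) \<le> C * \<bar>t\<bar> - C * 0" for t
    proof (rule norm_le_of_vector_derivative_bound[OF Q])
      show "((\<lambda>t. C * t) has_real_derivative C) (at t)" for t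
        by (auto intro!: derivative_eq_intros)
      show "norm (- cis (\<theta> t) * complex_of_vec2 (g t)) \<le> C" for t
        using g[of t] by (simp add: norm_mult)
    qed (simp add: Q_def \<theta>)
    then show "norm (cis (\<theta> t) * complex_of_vec2 (p t) - complex_of_vec2 (p 0)) \<le> C * \<bar>t\<bar>" for t
      by (simp add: Q_def P_def)
  qed
qed

text \<open>Uniqueness of lifts: two continuous lifts of one curve differ by a lattice vector, which
  cannot jump because distinct integers are at distance at least 1.\<close>

lemma continuous_vec_Ints_constant:
  fixes D :: "real \<Rightarrow> real^'n"
  assumes "continuous_on UNIV D" "\<And>t i. D t $ i \<in> \<int>"
  shows "D s = D t"
proof -
  have "D s $ i = D t $ i" for i
  proof -
    have "(\<lambda>t. D t $ i) constant_on UNIV"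
    proof (rule continuous_discrete_range_constant)
      show "continuous_on UNIV (\<lambda>t. D t $ i)" by (intro continuous_intros assms)
      fix x :: real
      have "1 \<le> norm (D y $ i - D x $ i)" if "D y $ i \<noteq> D x $ i" for y
        using Ints_nonzero_abs_ge1[of "D y $ i - D x $ i"] that assms(2) by simp
      then show "\<exists>e>0. \<forall>y. y \<in> UNIV \<and> D y $ i \<noteq> D x $ i \<longrightarrow> e \<le> norm (D y $ i - D x $ i)"
        by (intro exI[of _ 1]) auto
    qed simp
    then show ?thesis by (auto simp: constant_on_def)
  qed
  then show ?thesis by (simp add: vec_eq_iff)
qed

lemma vector_4:
  fixes w x y z :: "'a::zero"
  shows "(vector [w, x, y, z] :: 'a^4) $ 1 = w" "(vector [w, x, y, z] :: 'a^4) $ 2 = x"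
    "(vector [w, x, y, z] :: 'a^4) $ 3 = y" "(vector [w, x, y, z] :: 'a^4) $ 4 = z"
  by (simp_all add: vector_def)

lemma tangent_of_coords_tangent_coords: "tangent_of_coords (tangent_coords u) = u"
  by (simp add: tangent_of_coords_def tangent_coords_def prod_eq_iff vec_eq_iff forall_2 vector_4)

lemma tangent_det_nonzero_imp_inj:
  assumes "linear A" "tangent_det A \<noteq> 0"
  shows "inj A"
proof -
  define B where "B = tangent_coords \<circ> A \<circ> tangent_of_coords"
  have "linear tangent_coords"
    by (rule linearI) (simp_all add: tangent_coords_def vec_eq_iff forall_4 vector_4)
  moreover have "linear tangent_of_coords"
    by (rule linearI) (simp_all add: tangent_of_coords_def vec_eq_iff forall_2)
  ultimately have B: "linear B"
    unfolding B_def using assms(1) by (intro linear_compose)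
  have "invertible (matrix B)"
    using assms(2) by (simp add: tangent_det_def B_def invertible_det_nz)
  then have "inj ((*v) (matrix B))"
    by (simp add: invertible_left_inverse matrix_left_invertible_injective)
  then have injB: "inj B"
    using matrix_vector_mul(2)[OF B] by simp
  show ?thesis
  proof (rule injI)
    fix u v assume "A u = A v"
    then have "B (tangent_coords u) = B (tangent_coords v)"
      by (simp add: B_def tangent_of_coords_tangent_coords)
    then have "tangent_coords u = tangent_coords v" by (rule injD[OF injB])
    then show "u = v" by (metis tangent_of_coords_tangent_coords)
  qed
qed

section \<open>Lattice vectors and truncation of the momentum\<close>

definition lattice_vector :: "int^2 \<Rightarrow> real^2" where
  "lattice_vector h = (\<chi> i. of_int (h $ i))"

lemma lattice_vector_Ints: "\<forall>i. lattice_vector h $ i \<in> \<int>"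
  by (simp add: lattice_vector_def)

text \<open>For positive \<open>M\<close>, the radial retraction onto the ball of radius
  \<open>M\<close>. The position-Lipschitz constant of the magnetic force grows with the momentum;
  truncating the momentum bounds it.\<close>

definition radial_cutoff :: "real \<Rightarrow> real^2 \<Rightarrow> real^2" where
  "radial_cutoff M p = (M / max M (norm p)) *\<^sub>R p"

lemma norm_radial_cutoff_le: "M > 0 \<Longrightarrow> norm (radial_cutoff M p) \<le> M"
  by (simp add: radial_cutoff_def pos_divide_le_eq max_def)

lemma radial_cutoff_eq_self: "M > 0 \<Longrightarrow> norm p \<le> M \<Longrightarrow> radial_cutoff M p = p"
  by (simp add: radial_cutoff_def max_absorb1)

text \<open>One unit of the constant comes from the difference \<open>p - q\<close>, the other from
  the change of the scaling factor.\<close>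

lemma radial_cutoff_lipschitz:
  assumes "M > 0"
  shows "norm (radial_cutoff M p - radial_cutoff M q) \<le> 2 * norm (p - q)"
proof -
  define m n where "m = max M (norm p)" and "n = max M (norm q)"
  have mn: "m > 0" "n > 0" "m \<ge> M" "n \<ge> M" "norm q \<le> n" using assms by (auto simp: m_def n_def)
  have "\<bar>m - n\<bar> \<le> norm (p - q)"
    unfolding m_def n_def using norm_triangle_ineq3[of p q] by (auto simp: max_def)
  moreover have "\<bar>M / m - M / n\<bar> * norm q \<le> \<bar>m - n\<bar>"
  proof -
    have "\<bar>M / m - M / n\<bar> * norm q = (M / m) * \<bar>n - m\<bar> * (norm q / n)"
    proof -
      have "M / m - M / n = (M / m) * (n - m) / n" using mn by (simp add: field_simps)
      then show ?thesis using mn assms by (simp add: abs_mult)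
    qed
    also have "\<dots> \<le> 1 * \<bar>n - m\<bar> * 1"
      using mn assms by (intro mult_mono) auto
    finally show ?thesis by simp
  qed
  moreover have "norm (radial_cutoff M p - radial_cutoff M q) \<le> norm (p - q) + \<bar>M / m - M / n\<bar> * norm q"
  proof -
    have "radial_cutoff M p - radial_cutoff M q = (M / m) *\<^sub>R (p - q) + (M / m - M / n) *\<^sub>R q"
      by (simp add: radial_cutoff_def m_def n_def algebra_simps)
    moreover have "norm ((M / m) *\<^sub>R (p - q)) \<le> norm (p - q)"
    proof -
      have "M / m * norm (p - q) \<le> 1 * norm (p - q)"
        using mn by (intro mult_right_mono) auto
      then show ?thesis using mn assms by simp
    qed
    ultimately show ?thesis
      using norm_triangle_ineq[of "(M / m) *\<^sub>R (p - q)" "(M / m - M / n) *\<^sub>R q"] by simp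
  qed
  ultimately show ?thesis by linarith
qed

lemma gronwall_two_sided:
  fixes D D' :: "real \<Rightarrow> 'a::real_inner"
  assumes D: "\<And>t. (D has_vector_derivative D' t) (at t)"
    and le: "\<And>t. \<bar>t\<bar> \<le> T \<Longrightarrow> norm (D' t) \<le> K * norm (D t)"
    and t: "\<bar>t\<bar> \<le> T"
  shows "norm (D t) \<le> norm (D 0) * exp (K * \<bar>t\<bar>)"
proof (cases "t \<ge> 0")
  case True
  then show ?thesis
    using gronwall_inner[of T D D' K t] assms by auto
next
  case False
  have "((\<lambda>s. D (- s)) has_vector_derivative - D' (- s)) (at s)" for s
  proof -
    have "((\<lambda>s::real. - s) has_vector_derivative - 1) (at s)"
      by (auto intro!: derivative_eq_intros)
    from vector_diff_chain_at[OF this, of D "D' (-s)"] show ?thesis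
      using D[of "-s"] by (simp add: o_def)
  qed
  then show ?thesis
    using gronwall_inner[of T "\<lambda>s. D (- s)" "\<lambda>s. - D' (- s)" K "- t"] False le t by auto
qed

section \<open>The equations of motion on the universal cover\<close>

locale magnetic_torus =
  fixes \<tau> :: real and a :: "torus \<Rightarrow> real" and V :: "real \<Rightarrow> torus \<Rightarrow> real"
  assumes \<tau>_pos: "\<tau> > 0"
    and smooth_a: "smooth (\<lambda>x. a (torus_proj x))"
    and V_periodic: "V (t + \<tau>) q = V t q"
    and smooth_V: "smooth (\<lambda>(t, x). V t (torus_proj x))"
begin

definition potential_lift :: "real \<times> (real^2) \<Rightarrow> real" where
  "potential_lift = (\<lambda>(t, x). V t (torus_proj x))"

definition strength :: "real^2 \<Rightarrow> real" where
  "strength x = a (torus_proj x)"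

definition grad :: "real \<Rightarrow> real^2 \<Rightarrow> real^2" where
  "grad t x = (\<chi> i. frechet_derivative potential_lift (at (t, x)) (0, axis i 1))"

definition field :: "real \<Rightarrow> tangent \<Rightarrow> tangent" where
  "field t z = (snd z, - strength (fst z) *\<^sub>R rot90 (snd z) - grad t (fst z))"

definition form :: torus_form2 where "form q u v = a q * area_form q u v"

definition solution :: "(real \<Rightarrow> tangent) \<Rightarrow> bool" where
  "solution y \<longleftrightarrow> (\<forall>t. (y has_vector_derivative field t (y t)) (at t))"

lemma smooth_potential_lift: "smooth potential_lift"
  using smooth_V by (simp add: potential_lift_def)

lemma smooth_partial: "smooth (\<lambda>z. frechet_derivative potential_lift (at z) v)"
  by (rule smooth_frechet_derivative[OF smooth_potential_lift])

lemma periodic_partial: "torus_periodic \<tau> (\<lambda>z. frechet_derivative potential_lift (at z) v)"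
proof (rule torus_periodic_frechet_derivative[OF _ smooth_potential_lift])
  show "torus_periodic \<tau> potential_lift"
    by (auto simp: torus_periodic_def potential_lift_def V_periodic torus_proj_add_lattice)
qed

lemma smooth_strength: "smooth (\<lambda>z :: real \<times> (real^2). strength (snd z))"
  unfolding strength_def by (rule smooth_compose_snd[OF smooth_a])

lemma periodic_strength: "torus_periodic \<tau> (\<lambda>z. strength (snd z))"
  by (simp add: torus_periodic_def strength_def torus_proj_add_lattice)

lemma grad_add_period: "grad (t + \<tau>) x = grad t x"
  using periodic_partial by (simp add: grad_def torus_periodic_def)

lemma field_add_period: "field (t + \<tau>) z = field t z"
  by (simp add: field_def grad_add_period)

lemma field_add_lattice: "(\<forall>i. n $ i \<in> \<int>) \<Longrightarrow> field t (z + (n, 0)) = field t z"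
  using periodic_partial
  by (simp add: field_def grad_def torus_periodic_def strength_def torus_proj_add_lattice)

lemma continuous_strength: "continuous_on S strength"
  unfolding strength_def by (rule smooth_imp_continuous_on[OF smooth_a])

lemma continuous_grad: "continuous_on S (\<lambda>z. grad (fst z) (snd z))"
  unfolding grad_def prod.collapse
  by (intro continuous_on_vec_lambda smooth_imp_continuous_on smooth_partial)

section \<open>Uniform bounds for the field\<close>

lemma strength_bounded: "\<exists>C. \<forall>x. \<bar>strength x\<bar> \<le> C"
  using torus_periodic_bounded[OF \<tau>_pos periodic_strength smooth_imp_continuous_on[OF smooth_strength]]
  by (auto simp: real_norm_def)

lemma strength_lipschitz: "\<exists>C. \<forall>x y. \<bar>strength x - strength y\<bar> \<le> C * norm (x - y)"
  using torus_periodic_lipschitz[OF \<tau>_pos periodic_strength smooth_strength] by auto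

lemma grad_bounded: "\<exists>C. \<forall>t x. norm (grad t x) \<le> C"
proof -
  have "torus_periodic \<tau> (\<lambda>z. grad (fst z) (snd z))"
    using periodic_partial by (simp add: torus_periodic_def grad_def)
  from torus_periodic_bounded[OF \<tau>_pos this continuous_grad] show ?thesis by auto
qed

lemma grad_lipschitz: "\<exists>C. \<forall>t x y. norm (grad t x - grad t y) \<le> C * norm (x - y)"
proof -
  define G where "G = (\<lambda>i z. frechet_derivative potential_lift (at z) (0, axis i 1 :: real^2))"
  have "\<exists>C. \<forall>t x y. \<bar>G i (t, x) - G i (t, y)\<bar> \<le> C * norm (x - y)" for i
    unfolding G_def by (rule torus_periodic_lipschitz[OF \<tau>_pos periodic_partial smooth_partial])
  then obtain C where C: "\<And>i t x y. \<bar>G i (t, x) - G i (t, y)\<bar> \<le> C i * norm (x - y)"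
    by metis
  have "norm (grad t x - grad t y) \<le> (\<Sum>i\<in>UNIV. C i) * norm (x - y)" for t x y
  proof -
    have "norm (grad t x - grad t y) \<le> (\<Sum>i\<in>UNIV. \<bar>(grad t x - grad t y) $ i\<bar>)"
      by (rule norm_le_l1_cart)
    also have "\<dots> \<le> (\<Sum>i\<in>UNIV. C i * norm (x - y))"
      using C by (intro sum_mono) (simp add: grad_def G_def)
    finally show ?thesis by (simp add: sum_distrib_right)
  qed
  then show ?thesis by blast
qed

definition strength_bound :: real where "strength_bound = (SOME C. \<forall>x. \<bar>strength x\<bar> \<le> C)"
definition strength_lip :: real where
  "strength_lip = (SOME C. \<forall>x y. \<bar>strength x - strength y\<bar> \<le> C * norm (x - y))"
definition grad_bound :: real where "grad_bound = (SOME C. \<forall>t x. norm (grad t x) \<le> C)"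
definition grad_lip :: real where
  "grad_lip = (SOME C. \<forall>t x y. norm (grad t x - grad t y) \<le> C * norm (x - y))"

lemma strength_bound: "\<bar>strength x\<bar> \<le> strength_bound"
  using someI_ex[OF strength_bounded] unfolding strength_bound_def by blast

lemma strength_lip: "\<bar>strength x - strength y\<bar> \<le> strength_lip * norm (x - y)"
  using someI_ex[OF strength_lipschitz] unfolding strength_lip_def by blast

lemma grad_bound: "norm (grad t x) \<le> grad_bound"
  using someI_ex[OF grad_bounded] unfolding grad_bound_def by blast

lemma grad_lip: "norm (grad t x - grad t y) \<le> grad_lip * norm (x - y)"
  using someI_ex[OF grad_lipschitz] unfolding grad_lip_def by blast

lemma bounds_nonneg: "strength_bound \<ge> 0" "strength_lip \<ge> 0" "grad_bound \<ge> 0" "grad_lip \<ge> 0"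
proof -
  show "strength_bound \<ge> 0" using strength_bound[of 0] by linarith
  show "grad_bound \<ge> 0" using grad_bound[of 0 0] norm_ge_zero order_trans by blast
  \<comment> \<open>Two points at distance 1 turn each Lipschitz estimate into nonnegativity of its
    constant.\<close>
  have n: "norm (0 - axis 1 1 :: real^2) = 1" by (simp add: norm_axis_1)
  show "strength_lip \<ge> 0" using strength_lip[of 0 "axis 1 1"] unfolding n by linarith
  show "grad_lip \<ge> 0" using order_trans[OF norm_ge_zero grad_lip[of 0 0 "axis 1 1"]] unfolding n by linarith
qed

text \<open>A common Lipschitz estimate for the field (\<open>P\<close> the identity) and for its truncation.\<close>

lemma field_lipschitz_general:
  assumes P: "norm (P (snd z) - P (snd w)) \<le> 2 * norm (snd z - snd w)" "norm (P (snd w)) \<le> M"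
  shows "norm ((snd z, - strength (fst z) *\<^sub>R rot90 (P (snd z)) - grad t (fst z))
       - (snd w, - strength (fst w) *\<^sub>R rot90 (P (snd w)) - grad t (fst w)))
     \<le> (1 + 2 * strength_bound + strength_lip * M + grad_lip) * norm (z - w)"
proof -
  let ?N = "norm (z - w)"
  have 1: "norm (fst z - fst w) \<le> ?N" and 2: "norm (snd z - snd w) \<le> ?N"
    using norm_fst_le[of "fst z - fst w" "snd z - snd w"] norm_snd_le[of "snd z - snd w" "fst z - fst w"]
    by (simp_all add: minus_prod_def)
  interpret rot90: bounded_linear rot90 by (rule bounded_linear_rot90)
  have A: "norm (strength (fst z) *\<^sub>R rot90 (P (snd z)) - strength (fst w) *\<^sub>R rot90 (P (snd w)))
    \<le> (2 * strength_bound + strength_lip * M) * ?N"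
  proof -
    have eq: "strength (fst z) *\<^sub>R rot90 (P (snd z)) - strength (fst w) *\<^sub>R rot90 (P (snd w))
      = strength (fst z) *\<^sub>R rot90 (P (snd z) - P (snd w)) + (strength (fst z) - strength (fst w)) *\<^sub>R rot90 (P (snd w))"
      by (simp only: rot90.diff scaleR_diff_left scaleR_diff_right) simp
    have "norm (strength (fst z) *\<^sub>R rot90 (P (snd z) - P (snd w))) \<le> strength_bound * (2 * ?N)"
      using bounds_nonneg P 2 by (simp only: norm_scaleR norm_rot90, intro mult_mono strength_bound) auto
    moreover have "norm ((strength (fst z) - strength (fst w)) *\<^sub>R rot90 (P (snd w))) \<le> (strength_lip * ?N) * M"
    proof (simp only: norm_scaleR norm_rot90, intro mult_mono P)
      show "\<bar>strength (fst z) - strength (fst w)\<bar> \<le> strength_lip * ?N"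
        by (rule order_trans[OF strength_lip mult_left_mono[OF 1 bounds_nonneg(2)]])
    qed (use bounds_nonneg in auto)
    ultimately show ?thesis unfolding eq
      by (intro order_trans[OF norm_triangle_ineq]) (simp add: algebra_simps)
  qed
  have G: "norm (grad t (fst z) - grad t (fst w)) \<le> grad_lip * ?N"
    by (rule order_trans[OF grad_lip mult_left_mono[OF 1 bounds_nonneg(4)]])
  let ?q = "- strength (fst z) *\<^sub>R rot90 (P (snd z)) - grad t (fst z) - (- strength (fst w) *\<^sub>R rot90 (P (snd w)) - grad t (fst w))"
  have q: "norm ?q = norm ((strength (fst z) *\<^sub>R rot90 (P (snd z)) - strength (fst w) *\<^sub>R rot90 (P (snd w))) + (grad t (fst z) - grad t (fst w)))"
    by (subst norm_minus_cancel[symmetric], rule arg_cong[where f=norm]) simp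
  have "norm ?q \<le> (2 * strength_bound + strength_lip * M) * ?N + grad_lip * ?N"
    unfolding q by (rule norm_triangle_mono[OF A G])
  moreover have "norm ((snd z, - strength (fst z) *\<^sub>R rot90 (P (snd z)) - grad t (fst z))
       - (snd w, - strength (fst w) *\<^sub>R rot90 (P (snd w)) - grad t (fst w))) \<le> norm (snd z - snd w) + norm ?q"
    unfolding diff_Pair by (rule norm_Pair_le)
  moreover have "(1 + 2 * strength_bound + strength_lip * M + grad_lip) * ?N
      = ?N + ((2 * strength_bound + strength_lip * M) * ?N + grad_lip * ?N)"
    by (simp only: distrib_right mult_1_left add.assoc)
  ultimately show ?thesis using 2 by linarith
qed

text \<open>The magnetic force only rotates the momentum, so its norm grows through the potential
  alone. The coefficient \<open>b\<close> is arbitrary so that the bound also covers the truncated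
  equation.\<close>

lemma momentum_bound:
  fixes y :: "real \<Rightarrow> tangent"
  assumes y: "\<And>t. (y has_vector_derivative
      (snd (y t), - b t *\<^sub>R rot90 (snd (y t)) - grad t (fst (y t)))) (at t)"
    and b: "continuous_on UNIV b"
  shows "norm (snd (y t)) \<le> norm (snd (y 0)) + grad_bound * \<bar>t\<bar>"
proof -
  have "((\<lambda>t. snd (y t)) has_vector_derivative - b t *\<^sub>R rot90 (snd (y t)) - grad t (fst (y t))) (at t)" for t
    using bounded_linear.has_vector_derivative[OF bounded_linear_snd y] by simp
  from rotating_frame_bound[OF this b grad_bound] obtain \<theta> where
    "norm (cis (\<theta> t) * complex_of_vec2 (snd (y t)) - complex_of_vec2 (snd (y 0))) \<le> grad_bound * \<bar>t\<bar>"
    by metis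
  then have "norm (cis (\<theta> t) * complex_of_vec2 (snd (y t))) \<le> norm (complex_of_vec2 (snd (y 0))) + grad_bound * \<bar>t\<bar>"
    by (metis add.commute diff_add_cancel norm_triangle_le add_left_mono)
  then show ?thesis by (simp add: norm_mult)
qed

section \<open>Global existence, uniqueness and dependence on initial values\<close>

lemma solution_continuous: "solution y \<Longrightarrow> continuous_on S y"
  unfolding solution_def by (meson continuous_at_imp_continuous_on has_vector_derivative_continuous)

lemma continuous_strength_along:
  "continuous_on UNIV y \<Longrightarrow> continuous_on UNIV (\<lambda>t. strength (fst (y t)))"
  by (intro continuous_on_compose2[OF continuous_strength[of UNIV]] continuous_intros) auto

lemma solution_momentum_bound:
  assumes "solution y"
  shows "norm (snd (y t)) \<le> norm (snd (y 0)) + grad_bound * \<bar>t\<bar>"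
  using assms
  by (intro momentum_bound[where b="\<lambda>t. strength (fst (y t))"] continuous_strength_along solution_continuous)
    (auto simp: solution_def field_def)

text \<open>Solve the equation with momentum truncated at a radius above the a priori bound. That
  bound holds for the truncated equation too, so the truncation is never active.\<close>

lemma solution_exists: "\<exists>y. y 0 = z \<and> solution y"
proof -
  \<comment> \<open>The a priori momentum bound plus 1, which keeps the cutoff radius
    positive.\<close>
  define M where "M = (\<lambda>t. norm (snd z) + 1 + grad_bound * \<bar>t\<bar>)"
  have M: "M t > 0" for t
    unfolding M_def using mult_nonneg_nonneg[OF bounds_nonneg(3) abs_ge_zero[of t]] norm_ge_zero[of "snd z"]
    by linarith
  define f where "f = (\<lambda>t z. (snd z, - strength (fst z) *\<^sub>R rot90 (radial_cutoff (M t) (snd z)) - grad t (fst z)))"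
  \<comment> \<open>\<open>A\<close> and \<open>B\<close> split the Lipschitz constant for the
    radius \<open>M t\<close> into a constant part and linear growth in time;
    \<open>grad_bound\<close> in \<open>A\<close> also covers the field at the origin.\<close>
  define A where "A = 1 + 2 * strength_bound + strength_lip * (norm (snd z) + 1) + grad_lip + grad_bound"
  define B where "B = strength_lip * grad_bound"
  have cont: "continuous_on UNIV (\<lambda>(t, x). f t x)"
  proof -
    have "continuous_on UNIV (\<lambda>w :: real \<times> tangent. grad (fst w) (fst (snd w)))"
    proof -
      have "continuous_on UNIV (\<lambda>w :: real \<times> tangent. (fst w, fst (snd w)))"
        by (intro continuous_intros)
      from continuous_on_compose2[OF continuous_grad[of UNIV] this] show ?thesis by simp
    qed
    moreover have "continuous_on UNIV (\<lambda>w :: real \<times> tangent. strength (fst (snd w)))"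
      by (rule continuous_on_compose2[OF continuous_strength[of UNIV]]) (auto intro!: continuous_intros)
    moreover have "max (M s) x \<noteq> 0" for s x
      using M[of s] by (simp add: max_def)
    ultimately show ?thesis
      unfolding f_def case_prod_unfold radial_cutoff_def M_def
      by (intro continuous_intros bounded_linear.continuous_on[OF bounded_linear_rot90]) auto
  qed
  have lip: "norm (f t x - f t y) \<le> (A + B * \<bar>t\<bar>) * norm (x - y)" for t x y
  proof -
    have "norm (f t x - f t y) \<le> (1 + 2 * strength_bound + strength_lip * M t + grad_lip) * norm (x - y)"
      unfolding f_def
      by (rule field_lipschitz_general) (rule radial_cutoff_lipschitz[OF M] norm_radial_cutoff_le[OF M])+
    also have "\<dots> \<le> (A + B * \<bar>t\<bar>) * norm (x - y)"
      using bounds_nonneg(3) by (intro mult_right_mono) (auto simp: A_def B_def M_def algebra_simps)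
    finally show ?thesis .
  qed
  have bdd: "norm (f t 0) \<le> A + B * \<bar>t\<bar>" for t
  proof -
    have "norm (f t 0) \<le> grad_bound"
      using grad_bound bounded_linear_rot90 by (simp add: f_def radial_cutoff_def linear_simps norm_Pair)
    also have "\<dots> \<le> A + B * \<bar>t\<bar>"
      using bounds_nonneg by (simp add: A_def B_def)
    finally show ?thesis .
  qed
  obtain y where y: "y 0 = z" "\<And>t. (y has_vector_derivative f t (y t)) (at t)"
    using global_solution_exists[OF cont lip bdd] by metis
  have cy: "continuous_on UNIV y"
    using y(2) by (meson continuous_at_imp_continuous_on has_vector_derivative_continuous)
  \<comment> \<open>Truncation multiplies the momentum by a scalar, so the equation keeps the
    required shape with the scalar absorbed into \<open>b\<close>.\<close>
  have "norm (snd (y t)) \<le> norm (snd (y 0)) + grad_bound * \<bar>t\<bar>" for t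
  proof (rule momentum_bound)
    show "(y has_vector_derivative (snd (y t),
        - (strength (fst (y t)) * (M t / max (M t) (norm (snd (y t))))) *\<^sub>R rot90 (snd (y t)) - grad t (fst (y t)))) (at t)" for t
      using y(2)[of t] bounded_linear_rot90
      by (simp add: f_def radial_cutoff_def linear_simps)
    have "max (M t) x \<noteq> 0" for t x using M[of t] by (simp add: max_def)
    then show "continuous_on UNIV (\<lambda>t. strength (fst (y t)) * (M t / max (M t) (norm (snd (y t)))))"
      unfolding M_def by (intro continuous_intros continuous_strength_along cy) auto
  qed
  then have "norm (snd (y t)) \<le> M t" for t
    using y(1) by (force simp: M_def intro: order_trans)
  then have "f t (y t) = field t (y t)" for t
    using M by (simp add: f_def field_def radial_cutoff_eq_self)
  then show ?thesis using y by (auto simp: solution_def)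
qed

text \<open>On the time interval in question the momentum bound supplies a uniform Lipschitz
  constant along the solutions, and Gronwall's inequality applies.\<close>

lemma solution_dependence:
  assumes y: "solution y" "norm (snd (y 0)) \<le> r" and y': "solution y'" "norm (snd (y' 0)) \<le> r"
  shows "norm (y t - y' t) \<le> norm (y 0 - y' 0) *
    exp ((1 + 2 * strength_bound + strength_lip * (r + grad_bound * \<bar>t\<bar>) + grad_lip) * \<bar>t\<bar>)"
proof (rule gronwall_two_sided)
  show "((\<lambda>t. y t - y' t) has_vector_derivative field s (y s) - field s (y' s)) (at s)" for s
    using y y' by (intro has_vector_derivative_diff) (auto simp: solution_def)
  show "norm (field s (y s) - field s (y' s))
    \<le> (1 + 2 * strength_bound + strength_lip * (r + grad_bound * \<bar>t\<bar>) + grad_lip) * norm (y s - y' s)"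
    if "\<bar>s\<bar> \<le> \<bar>t\<bar>" for s
  proof -
    have "norm (snd (y' s)) \<le> norm (snd (y' 0)) + grad_bound * \<bar>s\<bar>"
      by (rule solution_momentum_bound[OF y'(1)])
    also have "\<dots> \<le> r + grad_bound * \<bar>t\<bar>"
      using y'(2) that bounds_nonneg by (intro add_mono mult_left_mono)
    finally show ?thesis
      unfolding field_def using field_lipschitz_general[of "\<lambda>p. p"] by simp
  qed
qed simp

lemma solution_unique:
  assumes "solution y" "solution y'" "y 0 = y' 0"
  shows "y = y'"
  using solution_dependence[of y "norm (snd (y 0))" y'] assms by (auto simp: fun_eq_iff)

section \<open>The flow and its symmetries\<close>

definition flow :: "tangent \<Rightarrow> real \<Rightarrow> tangent" where
  "flow z = (SOME y. y 0 = z \<and> solution y)"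

lemma flow: "flow z 0 = z" "solution (flow z)"
  using someI_ex[OF solution_exists[of z]] unfolding flow_def by auto

lemma flow_unique: "solution y \<Longrightarrow> y = flow (y 0)"
  using solution_unique flow by metis

text \<open>Deck transformations preserve the field, so by uniqueness they commute with the
  flow.\<close>

lemma flow_add_lattice:
  assumes "\<forall>i. n $ i \<in> \<int>"
  shows "flow (z + (n, 0)) t = flow z t + (n, 0)"
proof -
  have "solution (\<lambda>t. flow z t + (n, 0))"
    unfolding solution_def field_add_lattice[OF assms]
    using flow(2)[of z] has_vector_derivative_add[OF _ has_vector_derivative_const, of "flow z"]
    by (fastforce simp: solution_def)
  from flow_unique[OF this] show ?thesis by (metis flow(1))
qed

lemma flow_add_period:
  "flow z (t + \<tau>) = flow (flow z \<tau>) t"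
proof -
  have "solution (\<lambda>t. flow z (t + \<tau>))"
    unfolding solution_def
  proof
    fix t
    have "((\<lambda>t. t + \<tau>) has_vector_derivative 1) (at t)"
      by (auto intro!: derivative_eq_intros)
    moreover have "(flow z has_vector_derivative field (t + \<tau>) (flow z (t + \<tau>))) (at (t + \<tau>))"
      using flow(2) by (simp only: solution_def)
    ultimately show "((\<lambda>t. flow z (t + \<tau>)) has_vector_derivative field t (flow z (t + \<tau>))) (at t)"
      using vector_diff_chain_at[of "\<lambda>t. t + \<tau>" 1 t "flow z"] by (simp add: o_def field_add_period)
  qed
  from fun_cong[OF flow_unique[OF this], of t] show ?thesis by simp
qed

lemma continuous_flow: "continuous_on UNIV (\<lambda>z. flow z t)"
proof -
  have "isCont (\<lambda>z. flow z t) z" for z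
  proof -
    \<comment> \<open>The extra 1 allows one exponential factor for all initial points within
      distance 1 of \<open>z\<close>.\<close>
    define r where "r = norm (snd z) + 1"
    define E where "E = exp ((1 + 2 * strength_bound + strength_lip * (r + grad_bound * \<bar>t\<bar>) + grad_lip) * \<bar>t\<bar>)"
    have "norm (flow w t - flow z t) \<le> norm (w - z) * E" if "norm (w - z) < 1" for w
    proof -
      have "norm (snd w - snd z) \<le> norm (w - z)"
        using norm_snd_le[of "snd w - snd z" "fst w - fst z"] by (simp add: minus_prod_def)
      then have "norm (snd w) \<le> r"
        using that norm_triangle_ineq2[of "snd w" "snd z"] by (simp add: r_def)
      then show ?thesis
        unfolding E_def using solution_dependence[OF flow(2) _ flow(2), of w r z t]
        by (simp add: flow(1) r_def)
    qed
    then have ev: "\<forall>\<^sub>F w in at z. norm (flow w t - flow z t) \<le> norm (w - z) * E"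
      unfolding eventually_at by (intro exI[of _ 1]) (auto simp: dist_norm)
    have "((\<lambda>w. norm (w - z) * E) \<longlongrightarrow> norm (z - z) * E) (at z)"
      by (intro tendsto_intros)
    then have lim: "((\<lambda>w. norm (w - z) * E) \<longlongrightarrow> 0) (at z)"
      by simp
    have "((\<lambda>w. flow w t - flow z t) \<longlongrightarrow> 0) (at z)"
      by (rule Lim_null_comparison[OF ev lim])
    then show ?thesis by (simp add: isCont_def LIM_zero_iff)
  qed
  then show ?thesis by (simp add: continuous_on_eq_continuous_at)
qed

section \<open>Identification of the Hamiltonian vector field\<close>

lemma cotangent_differential_hamiltonian:
  "cotangent_differential (hamiltonian V t) (cotangent_proj z) v = snd z \<bullet> snd v + grad t (fst z) \<bullet> fst v"
proof -
  have "((\<lambda>x. potential_lift (t, x)) has_derivative (\<lambda>v. grad t (fst z) \<bullet> v)) (at (fst z + fst (0 :: tangent)))"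
    unfolding grad_def using has_derivative_space[OF smooth_potential_lift] by simp
  moreover have "((\<lambda>u :: tangent. fst z + fst u) has_derivative fst) (at 0)"
    by (auto intro!: derivative_eq_intros)
  ultimately have "((\<lambda>u :: tangent. potential_lift (t, fst z + fst u)) has_derivative (\<lambda>u. grad t (fst z) \<bullet> fst u)) (at 0)"
    by (rule has_derivative_compose[rotated])
  moreover have "((\<lambda>u :: tangent. (norm (snd z + snd u))\<^sup>2 / 2) has_derivative (\<lambda>u. snd z \<bullet> snd u)) (at 0)"
  proof -
    have d: "((\<lambda>u :: tangent. snd z + snd u) has_derivative snd) (at 0)"
      by (auto intro!: derivative_eq_intros)
    have "((\<lambda>u :: tangent. (snd z + snd u) \<bullet> (snd z + snd u) * (1 / 2)) has_derivative (\<lambda>u. snd z \<bullet> snd u)) (at 0)"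
      by (rule has_derivative_eq_rhs[OF has_derivative_mult_left[OF has_derivative_inner[OF d d]]])
        (simp add: inner_commute[of _ "snd z"])
    then show ?thesis by (simp add: power2_norm_eq_inner)
  qed
  ultimately have D: "((\<lambda>u :: tangent. (norm (snd z + snd u))\<^sup>2 / 2 + potential_lift (t, fst z + fst u))
      has_derivative (\<lambda>u. snd z \<bullet> snd u + grad t (fst z) \<bullet> fst u)) (at 0)"
    by (rule has_derivative_add[rotated])
  have H: "(\<lambda>u. hamiltonian V t (cotangent_translate (cotangent_proj z) u))
      = (\<lambda>u :: tangent. (norm (snd z + snd u))\<^sup>2 / 2 + potential_lift (t, fst z + fst u))"
    unfolding cotangent_translate_proj
    by (simp add: hamiltonian_def potential_lift_def cotangent_proj_def)
  show ?thesis
    unfolding cotangent_differential_def H has_derivative_imp_frechet_derivative[OF D] ..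
qed

text \<open>Nondegeneracy of the magnetic form makes the defining equation uniquely solvable:
  testing the two residuals against themselves forces both to vanish, which justifies the
  \<open>THE\<close>.\<close>

lemma hamiltonian_field_eq: "hamiltonian_field form V t (cotangent_proj z) = field t z"
proof -
  have iff: "(\<forall>v. magnetic_form form (cotangent_proj z) X v = - cotangent_differential (hamiltonian V t) (cotangent_proj z) v)
     \<longleftrightarrow> X = field t z" for X
  proof -
    define r where "r = snd X + strength (fst z) *\<^sub>R rot90 (fst X) + grad t (fst z)"
    have "magnetic_form form (cotangent_proj z) X v = - cotangent_differential (hamiltonian V t) (cotangent_proj z) v
       \<longleftrightarrow> r \<bullet> fst v = (fst X - snd z) \<bullet> snd v" for v
    proof -
      have "r \<bullet> fst v = snd X \<bullet> fst v + strength (fst z) * (rot90 (fst X) \<bullet> fst v) + grad t (fst z) \<bullet> fst v"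
        by (simp add: r_def inner_add_left)
      moreover have "(fst X - snd z) \<bullet> snd v = snd v \<bullet> fst X - snd z \<bullet> snd v"
        by (simp add: inner_diff_left inner_commute[of "snd v"])
      moreover have "form (fst (cotangent_proj z)) (fst X) (fst v) = strength (fst z) * (rot90 (fst X) \<bullet> fst v)"
        by (simp add: form_def area_form_eq cotangent_proj_def strength_def)
      ultimately show ?thesis
        unfolding cotangent_differential_hamiltonian magnetic_form_eq by (intro iffI; linarith)
    qed
    moreover have "(\<forall>v. r \<bullet> fst v = (fst X - snd z) \<bullet> snd v) \<longleftrightarrow> r = 0 \<and> fst X = snd z"
    proof
      assume *: "\<forall>v. r \<bullet> fst v = (fst X - snd z) \<bullet> snd v"
      from *[rule_format, of "(r, 0)"] *[rule_format, of "(0, fst X - snd z)"]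
      show "r = 0 \<and> fst X = snd z" by simp
    qed simp
    moreover have "r = 0 \<and> fst X = snd z \<longleftrightarrow> X = field t z"
    proof -
      have "r = snd X - (- strength (fst z) *\<^sub>R rot90 (fst X) - grad t (fst z))"
        by (simp add: r_def)
      then show ?thesis by (auto simp: field_def prod_eq_iff)
    qed
    ultimately show ?thesis by (simp only:)
  qed
  show ?thesis
    unfolding hamiltonian_field_def iff by simp
qed

text \<open>Bootstrapping in time: if the curve has order \<open>n\<close>, so has the field along
  it, which is its derivative.\<close>

lemma times_cont_differentiable_flow: "times_cont_differentiable n (flow z)"
proof (induction n)
  case 0
  then show ?case by (simp add: solution_continuous[OF flow(2)])
next
  case (Suc n)
  let ?W = "flow z"
  have x: "times_cont_differentiable n (\<lambda>t. fst (?W t))" and p: "times_cont_differentiable n (\<lambda>t. snd (?W t))"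
    by (intro times_cont_differentiable_linear_image[OF bounded_linear_fst] times_cont_differentiable_linear_image[OF bounded_linear_snd] Suc)+
  have tx: "times_cont_differentiable n (\<lambda>t :: real. (t, fst (?W t)))"
    by (intro times_cont_differentiable_Pair times_cont_differentiable_bounded_linear bounded_linear_ident x)
  have "times_cont_differentiable n (\<lambda>t. strength (fst (?W t)))"
    using times_cont_differentiable_compose[OF _ tx, of "\<lambda>z. strength (snd z)"] smooth_strength
    by (simp add: smooth_def)
  then have B: "times_cont_differentiable n (\<lambda>t. strength (fst (?W t)) *\<^sub>R rot90 (snd (?W t)))"
    by (intro times_cont_differentiable_bilinear[OF bounded_bilinear_scaleR]
        times_cont_differentiable_linear_image[OF bounded_linear_rot90] p)
  have G: "times_cont_differentiable n (\<lambda>t. grad t (fst (?W t)))"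
    unfolding grad_def
    using times_cont_differentiable_compose[OF _ tx, of "\<lambda>z. frechet_derivative potential_lift (at z) _"] smooth_partial
    by (intro times_cont_differentiable_vec_lambda) (simp add: smooth_def)
  have "field t (?W t) = (snd (?W t), - (strength (fst (?W t)) *\<^sub>R rot90 (snd (?W t)) + grad t (fst (?W t))))" for t
    by (simp add: field_def)
  then have F: "times_cont_differentiable n (\<lambda>t. field t (?W t))"
    using times_cont_differentiable_Pair[OF p times_cont_differentiable_linear_image[OF
        bounded_linear_minus[OF bounded_linear_ident] times_cont_differentiable_add[OF B G]]] by simp
  show ?case
  proof (rule times_cont_differentiable_SucI)
    show "(?W has_derivative (\<lambda>v. v *\<^sub>R field t (?W t))) (at t)" for t
      using flow(2) by (simp add: solution_def has_vector_derivative_def)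
    show "times_cont_differentiable n (\<lambda>t. v *\<^sub>R field t (?W t))" for v
      by (intro times_cont_differentiable_bilinear[OF bounded_bilinear_scaleR] times_cont_differentiable_const F)
  qed
qed

section \<open>Integral curves and the flow on the cotangent bundle\<close>

lemma cotangent_proj_flow_cong:
  assumes "cotangent_proj z = cotangent_proj z'"
  shows "cotangent_proj (flow z t) = cotangent_proj (flow z' t)"
proof -
  define n where "n = fst z - fst z'"
  have n: "\<forall>i. n $ i \<in> \<int>" and z: "z = z' + (n, 0)"
    using assms unfolding cotangent_proj_eq_iff by (simp_all add: n_def prod_eq_iff)
  show ?thesis
    unfolding z flow_add_lattice[OF n] using n by (simp add: cotangent_proj_eq_iff)
qed

lemma integral_curve_iff: "integral_curve form V w \<longleftrightarrow> (\<exists>z. w = cotangent_proj \<circ> flow z)"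
proof
  assume "integral_curve form V w"
  then obtain W where W: "\<And>t. w t = cotangent_proj (W t)"
    "\<And>t. (W has_vector_derivative hamiltonian_field form V t (w t)) (at t)"
    unfolding integral_curve_def by blast
  then have sol: "solution W"
    by (simp add: solution_def hamiltonian_field_eq)
  have "w = cotangent_proj \<circ> flow (W 0)"
    unfolding flow_unique[OF sol, symmetric] using W(1) by (simp add: fun_eq_iff)
  then show "\<exists>z. w = cotangent_proj \<circ> flow z" ..
next
  assume "\<exists>z. w = cotangent_proj \<circ> flow z"
  then obtain z where "w = cotangent_proj \<circ> flow z" ..
  then show "integral_curve form V w"
    unfolding integral_curve_def using flow(2)
    by (intro exI[of _ "flow z"]) (simp add: solution_def hamiltonian_field_eq)
qed

lemma integral_curve_flow: "integral_curve form V (cotangent_proj \<circ> flow z)"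
  unfolding integral_curve_iff by (rule exI) (rule refl)

lemma magnetic_flow_eq: "magnetic_flow form V t (cotangent_proj z) = cotangent_proj (flow z t)"
proof -
  have "(THE w. integral_curve form V w \<and> w 0 = cotangent_proj z) = cotangent_proj \<circ> flow z"
  proof (rule the_equality)
    show "integral_curve form V (cotangent_proj \<circ> flow z) \<and> (cotangent_proj \<circ> flow z) 0 = cotangent_proj z"
      using integral_curve_flow by (simp add: flow)
    fix w assume "integral_curve form V w \<and> w 0 = cotangent_proj z"
    then obtain z' where z': "w = cotangent_proj \<circ> flow z'" "cotangent_proj z' = cotangent_proj z"
      by (auto simp: integral_curve_iff flow)
    then show "w = cotangent_proj \<circ> flow z"
      by (simp add: fun_eq_iff cotangent_proj_flow_cong[OF z'(2)])
  qed
  then show ?thesis by (simp add: magnetic_flow_def)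
qed

section \<open>Periodic orbits as fixed points up to translation\<close>

lemma periodic_orbit_of_fixed_point:
  assumes "flow z \<tau> = z + (lattice_vector h, 0)"
  shows "cotangent_proj \<circ> flow z \<in> periodic_orbits_in_class \<tau> h form V"
proof -
  have "cotangent_proj (flow z (t + \<tau>)) = cotangent_proj (flow z t)" for t
    unfolding flow_add_period assms flow_add_lattice[OF lattice_vector_Ints]
    using lattice_vector_Ints by (simp add: cotangent_proj_eq_iff)
  moreover have "smooth (flow z)"
    by (simp add: smooth_def times_cont_differentiable_flow)
  moreover have "represents \<tau> (cotangent_proj \<circ> flow z) h"
    unfolding represents_def
    by (intro exI[of _ "flow z"]) (simp add: assms flow lattice_vector_def solution_continuous[OF flow(2)])
  ultimately show ?thesis
    using integral_curve_flow[of z] unfolding periodic_orbits_in_class_def periodic_orbits_def by auto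
qed

text \<open>The lift that witnesses the class differs from the lift by the flow by a constant
  lattice vector, so both have the same displacement over one period.\<close>

lemma periodic_orbit_imp_fixed_point:
  assumes "w \<in> periodic_orbits_in_class \<tau> h form V"
  obtains z where "w = cotangent_proj \<circ> flow z" "flow z \<tau> = z + (lattice_vector h, 0)"
proof -
  obtain z where w: "w = cotangent_proj \<circ> flow z"
    using assms unfolding periodic_orbits_in_class_def periodic_orbits_def integral_curve_iff by auto
  obtain W where W: "continuous_on UNIV W" "w = cotangent_proj \<circ> W"
      "fst (W \<tau>) = fst (W 0) + lattice_vector h"
    using assms unfolding periodic_orbits_in_class_def represents_def lattice_vector_def by auto
  have "w (0 + \<tau>) = w 0"
    using assms unfolding periodic_orbits_in_class_def periodic_orbits_def by blast
  then have p: "snd (flow z \<tau>) = snd z"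
    by (simp add: w cotangent_proj_def flow)
  have "cotangent_proj (W t) = cotangent_proj (flow z t)" for t
    using w W(2) by (simp add: fun_eq_iff)
  then have "fst (W \<tau>) - fst (flow z \<tau>) = fst (W 0) - fst (flow z 0)"
    by (intro continuous_vec_Ints_constant[of "\<lambda>t. fst (W t) - fst (flow z t)"] continuous_intros W
        solution_continuous[OF flow(2)]) (simp add: cotangent_proj_eq_iff)
  then have "fst (flow z \<tau>) = fst z + lattice_vector h"
    using W(3) by (simp add: flow algebra_simps)
  then show ?thesis using p by (intro that[of z] w) (simp add: prod_eq_iff)
qed

text \<open>If the momentum returns to \<open>p\<close>, the rotating frame bounds
  \<open>norm (cis (\<theta> \<tau>) - 1) * norm p\<close> by \<open>grad_bound * \<tau>\<close>.
  Non-resonance and compactness keep the first factor away from 0, so \<open>norm p\<close> is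
  bounded.\<close>

lemma large_momentum_not_fixed:
  assumes nonres: "\<And>q. 2 * pi * of_int k / \<tau> < a q" "\<And>q. a q < 2 * pi * (of_int k + 1) / \<tau>"
  shows "\<exists>R. \<forall>x p. R \<le> norm p \<longrightarrow> snd (flow (x, p) \<tau>) \<noteq> p"
proof -
  \<comment> \<open>The distance from 1 of the rotation over one period under constant field
    strength. Bounding its reciprocal yields a positive lower bound.\<close>
  define F where "F = (\<lambda>x. norm (cis (\<tau> * strength x) - 1))"
  have "torus_periodic \<tau> (\<lambda>z. 1 / F (snd z))"
    using periodic_strength by (simp add: torus_periodic_def F_def)
  moreover have Fpos: "F x > 0" for x
  proof -
    have "cis (\<tau> * strength x) \<noteq> 1"
    proof
      assume "cis (\<tau> * strength x) = 1"
      then obtain n :: int where n: "\<tau> * strength x = of_int (2 * n) * pi"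
        by (auto simp: cis_conv_exp exp_eq_1)
      \<comment> \<open>An integer \<open>n\<close> would lie strictly between \<open>k\<close> and
        \<open>k + 1\<close>.\<close>
      have "2 * pi * of_int k < \<tau> * strength x" "\<tau> * strength x < 2 * pi * (of_int k + 1)"
        using nonres[of "torus_proj x"] \<tau>_pos by (simp_all add: strength_def field_simps)
      then have "2 * pi * of_int k < 2 * pi * of_int n" "2 * pi * of_int n < 2 * pi * of_int (k + 1)"
        unfolding n by (simp_all add: mult_ac)
      then have "k < n" "n < k + 1"
        by (simp_all only: mult_less_cancel_left_pos[of "2 * pi"] pi_gt_zero zero_less_mult_iff zero_less_numeral of_int_less_iff simp_thms)
      then show False by simp
    qed
    then show ?thesis by (simp add: F_def)
  qed
  moreover have "continuous_on UNIV (\<lambda>z :: real \<times> (real^2). 1 / F (snd z))"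
  proof -
    have "continuous_on UNIV (\<lambda>z :: real \<times> (real^2). strength (snd z))"
      by (rule smooth_imp_continuous_on[OF smooth_strength])
    then have "continuous_on UNIV (\<lambda>z :: real \<times> (real^2). F (snd z))"
      unfolding F_def by (intro continuous_intros)
    then show ?thesis using Fpos by (intro continuous_intros) (auto simp: less_imp_neq[symmetric])
  qed
  ultimately obtain C where C: "\<And>z :: real \<times> (real^2). norm (1 / F (snd z)) \<le> C"
    using torus_periodic_bounded[OF \<tau>_pos] by blast
  have C1: "1 \<le> C * F x" for x
    using C[of "(0, x)"] Fpos[of x] by (simp add: divide_le_eq)
  have "snd (flow (x, p) \<tau>) \<noteq> p" if p: "norm p \<ge> C * (grad_bound * \<tau>) + 1" for x p
  proof
    assume fixed: "snd (flow (x, p) \<tau>) = p"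
    let ?y = "flow (x, p)"
    have "((\<lambda>t. snd (?y t)) has_vector_derivative
        - strength (fst (?y t)) *\<^sub>R rot90 (snd (?y t)) - grad t (fst (?y t))) (at t)" for t
      using flow(2)[of "(x, p)"] bounded_linear.has_vector_derivative[OF bounded_linear_snd, of ?y]
      by (fastforce simp: solution_def field_def)
    from rotating_frame_bound[OF this continuous_strength_along[OF solution_continuous[OF flow(2)]] grad_bound]
    obtain \<theta> where \<theta>: "\<theta> 0 = 0" "\<And>t. (\<theta> has_real_derivative strength (fst (?y t))) (at t)"
      "\<And>t. norm (cis (\<theta> t) * complex_of_vec2 (snd (?y t)) - complex_of_vec2 (snd (?y 0))) \<le> grad_bound * \<bar>t\<bar>"
      by metis
    \<comment> \<open>By the mean value theorem the total angle is \<open>\<tau>\<close> times the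
      field strength at one point of the orbit, so the lower bound for \<open>F\<close> applies to
      it.\<close>
    obtain s where "\<theta> \<tau> - \<theta> 0 = (\<tau> - 0) * strength (fst (?y s))"
      using MVT2[OF \<tau>_pos, of \<theta> "\<lambda>t. strength (fst (?y t))"] \<theta>(2) by blast
    then have "F (fst (?y s)) = norm (cis (\<theta> \<tau>) - 1)"
      using \<theta>(1) by (simp add: F_def)
    moreover have "norm (cis (\<theta> \<tau>) - 1) * norm p \<le> grad_bound * \<tau>"
    proof -
      have "cis (\<theta> \<tau>) * complex_of_vec2 p - complex_of_vec2 p = (cis (\<theta> \<tau>) - 1) * complex_of_vec2 p"
        by (simp add: algebra_simps)
      then show ?thesis
        using \<theta>(3)[of \<tau>] \<tau>_pos fixed flow(1)[of "(x, p)"] by (simp add: norm_mult)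
    qed
    ultimately have le: "F (fst (?y s)) * norm p \<le> grad_bound * \<tau>" by simp
    have "C \<ge> 0" using C[of 0] norm_ge_zero order_trans by blast
    have "norm p = 1 * norm p" by simp
    also have "\<dots> \<le> C * F (fst (?y s)) * norm p"
      by (intro mult_right_mono C1) simp
    also have "\<dots> \<le> C * (grad_bound * \<tau>)"
      using mult_left_mono[OF le \<open>C \<ge> 0\<close>] by (simp only: mult.assoc)
    finally show False using p by linarith
  qed
  then show ?thesis by blast
qed

text \<open>The increment \<open>G\<close> on the cotangent bundle and that of the lifted flow
  differ by a lattice vector which is continuous at 0 and vanishes there. It is therefore 0 near 0,
  and the derivatives coincide.\<close>

lemma flow_has_derivative_of_magnetic_flow:
  assumes "has_cotangent_derivative (magnetic_flow form V t) L (cotangent_proj z)"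
  shows "((\<lambda>z. flow z t) has_derivative L) (at z)"
proof -
  obtain G where G: "\<And>u. magnetic_flow form V t (cotangent_translate (cotangent_proj z) u)
        = cotangent_translate (magnetic_flow form V t (cotangent_proj z)) (G u)"
      "G 0 = 0" "(G has_derivative L) (at 0)"
    using assms unfolding has_cotangent_derivative_def by blast
  define E where "E = (\<lambda>u. flow (z + u) t - (flow z t + G u))"
  have proj: "cotangent_proj (flow (z + u) t) = cotangent_proj (flow z t + G u)" for u
    using G(1)[of u] unfolding cotangent_translate_proj magnetic_flow_eq .
  have "isCont E 0"
  proof -
    have "isCont (\<lambda>u. flow (z + u) t) 0"
    proof -
      have "continuous_on UNIV (\<lambda>u. flow (z + u) t)"
        by (intro continuous_on_compose2[OF continuous_flow] continuous_intros) simp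
      then show ?thesis using continuous_on_eq_continuous_at open_UNIV by blast
    qed
    then show ?thesis
      unfolding E_def by (intro continuous_intros has_derivative_continuous[OF G(3)])
  qed
  moreover have "E 0 = 0" by (simp add: E_def G)
  ultimately have "(E \<longlongrightarrow> 0) (at 0)" by (simp add: isCont_def)
  \<comment> \<open>A nonzero lattice vector has norm at least 1.\<close>
  then have "\<forall>\<^sub>F u in at 0. norm (E u) < 1"
    using tendstoD[of E 0 "at 0" 1] by simp
  then have ev: "\<forall>\<^sub>F u in at 0. flow z t + G u = flow (z + u) t"
  proof (rule eventually_mono)
    fix u assume u: "norm (E u) < 1"
    have "snd (E u) = 0" and int: "\<And>i. fst (E u) $ i \<in> \<int>"
      using proj[of u] unfolding cotangent_proj_eq_iff by (simp_all add: E_def)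
    moreover have "fst (E u) $ i = 0" for i
    proof (rule ccontr)
      assume "fst (E u) $ i \<noteq> 0"
      then have "1 \<le> \<bar>fst (E u) $ i\<bar>" using Ints_nonzero_abs_ge1 int by blast
      also have "\<dots> \<le> norm (fst (E u))" by (rule component_le_norm_cart)
      also have "\<dots> \<le> norm (E u)" by (metis norm_fst_le prod.collapse)
      finally show False using u by simp
    qed
    ultimately have "E u = 0" by (simp add: prod_eq_iff vec_eq_iff)
    then show "flow z t + G u = flow (z + u) t" by (simp add: E_def)
  qed
  have "((\<lambda>u. flow z t + G u) has_derivative L) (at 0)"
    using has_derivative_add[OF has_derivative_const G(3)] by simp
  then have D: "((\<lambda>u. flow (z + u) t) has_derivative L) (at 0)"
    by (rule has_derivative_transform_eventually[OF _ ev]) (simp_all add: G(2))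
  have "((\<lambda>w. w - z) has_derivative (\<lambda>v. v)) (at z)"
    by (auto intro!: derivative_eq_intros)
  from has_derivative_compose[OF this, of "\<lambda>u. flow (z + u) t" L] D show ?thesis by simp
qed

text \<open>If \<open>w\<close> were alone in its class, the displacement map \<open>G\<close> would
  vanish only at the lattice translates of \<open>z0\<close>. Its derivative there, \<open>L\<close>
  minus the identity, is injective by nondegeneracy, and its momentum component has no zero at large
  momentum; this contradicts the topological obstruction.\<close>

theorem two_periodic_orbits:
  assumes nonres: "\<And>q. 2 * pi * of_int k / \<tau> < a q" "\<And>q. a q < 2 * pi * (of_int k + 1) / \<tau>"
    and w: "w \<in> periodic_orbits_in_class \<tau> h form V"
    and nondeg: "nondegenerate_orbit \<tau> form V w"
  shows "\<exists>w'\<in>periodic_orbits_in_class \<tau> h form V. w' \<noteq> w"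
proof (rule ccontr)
  assume "\<not> ?thesis"
  then have only: "w' = w" if "w' \<in> periodic_orbits_in_class \<tau> h form V" for w'
    using that by blast
  obtain z0 where z0: "w = cotangent_proj \<circ> flow z0" "flow z0 \<tau> = z0 + (lattice_vector h, 0)"
    using periodic_orbit_imp_fixed_point[OF w] by blast
  obtain R where R: "\<And>x p. R \<le> norm p \<Longrightarrow> snd (flow (x, p) \<tau>) \<noteq> p"
    using large_momentum_not_fixed[OF nonres] by blast
  obtain L where L: "has_cotangent_derivative (magnetic_flow form V \<tau>) L (cotangent_proj z0)"
      "tangent_det (\<lambda>u. L u - u) \<noteq> 0"
    using nondeg by (auto simp: nondegenerate_orbit_def z0 flow)
  note dL = flow_has_derivative_of_magnetic_flow[OF L(1)]
  define G where "G = (\<lambda>z. flow z \<tau> - z - (lattice_vector h, 0))"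
  have dG: "(G has_derivative (\<lambda>u. L u - u)) (at z0)"
    using has_derivative_diff[OF has_derivative_diff[OF dL has_derivative_ident] has_derivative_const]
    by (simp add: G_def)
  show False
  proof (rule unique_regular_zero_impossible[OF _ _ _ _ _ dG])
    show "continuous_on UNIV G"
      unfolding G_def by (intro continuous_intros continuous_flow)
    show "G (x + n, p) = G (x, p)" if "\<forall>i. n $ i \<in> \<int>" for x n p
      using flow_add_lattice[OF that, of "(x, p)" \<tau>] by (simp add: G_def prod_eq_iff)
    show "snd (G (x, p)) \<noteq> 0" if "R \<le> norm p" for x p
      using R[OF that] by (simp add: G_def)
    show "G z0 = 0" by (simp add: G_def z0)
    show "snd z = snd z0 \<and> (\<forall>i. fst z $ i - fst z0 $ i \<in> \<int>)" if "G z = 0" for z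
    proof -
      have "flow z \<tau> = z + (lattice_vector h, 0)" using that by (simp add: G_def algebra_simps)
      then have "cotangent_proj \<circ> flow z = cotangent_proj \<circ> flow z0"
        unfolding z0(1)[symmetric] by (intro only periodic_orbit_of_fixed_point)
      from fun_cong[OF this, of 0] show ?thesis
        by (simp add: flow(1) cotangent_proj_eq_iff)
    qed
    show "inj (\<lambda>u. L u - u)"
      by (rule tangent_det_nonzero_imp_inj[OF has_derivative_linear[OF dG] L(2)])
  qed
qed

end

theorem theoremB:
  fixes \<tau> :: real and \<sigma> :: torus_form2 and V :: "real \<Rightarrow> torus \<Rightarrow> real"
    and h :: "int^2" and w :: "real \<Rightarrow> cotangent"
  assumes "\<tau> > 0"
    and "torus_two_form \<sigma>"
    and "nonresonant \<tau> \<sigma>"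
    and "periodic_potential \<tau> V"
    and "h \<noteq> 0"
    and "w \<in> periodic_orbits_in_class \<tau> h \<sigma> V"
    and "nondegenerate_orbit \<tau> \<sigma> V w"
  shows "infinite (periodic_orbits_in_class \<tau> h \<sigma> V) \<or>
         card (periodic_orbits_in_class \<tau> h \<sigma> V) \<ge> 2"
proof -
  obtain a :: "torus \<Rightarrow> real" and k :: int where a: "smooth (\<lambda>x. a (torus_proj x))"
      "\<And>q u v. \<sigma> q u v = a q * area_form q u v"
      "\<And>q. 2 * pi * of_int k / \<tau> < a q" "\<And>q. a q < 2 * pi * (of_int k + 1) / \<tau>"
    using assms(3) unfolding nonresonant_def by blast
  interpret magnetic_torus \<tau> a V
    using assms(1,4) a(1) by unfold_locales (auto simp: periodic_potential_def)
  have "\<sigma> = form" by (intro ext) (simp add: a(2) form_def)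
  then obtain w' where w': "w' \<in> periodic_orbits_in_class \<tau> h \<sigma> V" "w' \<noteq> w"
    using two_periodic_orbits[OF a(3,4)] assms(6,7) by blast
  \<comment> \<open>The finite case is treated separately because \<open>card\<close> of an infinite
    set is 0.\<close>
  have "card {w, w'} \<le> card (periodic_orbits_in_class \<tau> h \<sigma> V)"
    if "finite (periodic_orbits_in_class \<tau> h \<sigma> V)"
    using that assms(6) w' by (intro card_mono) auto
  then show ?thesis using w' by auto
qed

end
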